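(* For all $x\in\mathbb{C}\setminus\{0\}$, $$\mathcal{U}(-x;q) = f_{2,1}(x) = \frac{1}{(q)_{\infty}} f_{1,2,3}(x^{-1}q^2,q^3;q).$$
   Context: Throughout, $q\in\mathbb{C}$ with $0<|q|<1$. $(x)_n=(x;q)_n=\prod_{i=0}^{n-1}(1-xq^i)$, $(x)_\infty=\prod_{i\ge0}(1-xq^i)$, $(q)_\infty=(q;q)_\infty$, $\Theta(x;q)=(x)_\infty(q/x)_\infty(q)_\infty$. $\mathcal{U}(x;q)=\mathcal{U}_1^{(1)}(x;q)$ is the function $$\mathcal{U}(x;q)=\sum_{n=0}^\infty q^n(-x)_n(-q/x)_n$$ (the polynomials $H_n(1,1;0;q)$ occurring in the general definition $\mathcal U_t^{(m)}(x;q)=\sum_{n\ge0}q^n(-x)_n(-q/x)_nH_n(t,m;0;q)$ are empty products equal to $1$ for $t=m=1$). $\mathrm{sg}(r)=1$ if $r\ge0$ and $-1$ if $r<0$; $\mathrm{sg}(r,s)=\frac{\mathrm{sg}(r)+\mathrm{sg}(s)}{2}$. $f_{2,1}$ (two indices) is $$f_{2,1}(x)=\frac{\Theta(x;q)}{(q)_\infty^3}\sum_{\substack{r,s\in\mathbb{Z}\\ r\equiv s\ (\mathrm{mod}\ 2)}} \mathrm{sg}(r,s) \frac{(-1)^{\frac{r-s}{2}}q^{\frac{r^2}{8}+\frac{7}{4}rs+\frac{s^2}{8}+\frac{5}{4}r+\frac{3}{4}s}}{1-xq^{\frac{r+s}{2}}},$$ regarded as a function on $\mathbb{C}\setminus\{0\}$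 (it has no poles; values at integer powers of $q$ are given by the holomorphic extension). For positive integers $a,b,c$ with $b^2-ac>0$ (three indices), $$f_{a,b,c}(x,y;q) = \sum_{r,s \in \mathbb{Z}} \mathrm{sg}(r,s) (-1)^{r+s} x^r y^s q^{a\binom{r}{2}+brs+c\binom{s}{2}}.$$ *)

theory Defs
  imports "HOL-Analysis.Analysis"
begin

definition qpoch :: "complex \<Rightarrow> complex \<Rightarrow> nat \<Rightarrow> complex" where
  "qpoch x q n = (\<Prod>i<n. 1 - x * q ^ i)"

definition qpoch_inf :: "complex \<Rightarrow> complex \<Rightarrow> complex" where
  "qpoch_inf x q = (\<Prod>i. 1 - x * q ^ i)"

definition Theta :: "complex \<Rightarrow> complex \<Rightarrow> complex" where
  "Theta x q = qpoch_inf x q * qpoch_inf (q / x) q * qpoch_inf q q"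

definition U :: "complex \<Rightarrow> complex \<Rightarrow> complex" where
  "U x q = (\<Sum>n. q ^ n * qpoch (- x) q n * qpoch (- q / x) q n)"

definition sg :: "int \<Rightarrow> complex" where
  "sg r = (if r \<ge> 0 then 1 else - 1)"

definition sg2 :: "int \<Rightarrow> int \<Rightarrow> complex" where
  "sg2 r s = (sg r + sg s) / 2"

text \<open>The exponent
  $r^2/8 + 7rs/4 + s^2/8 + 5r/4 + 3s/4$ of $q$ is an integer whenever $r \equiv s$ (mod 2), so
  that no choice of a root of $q$ is involved; it is written with exact integer division:\<close>

lemma f21_exponent_exact:
  fixes r s :: int
  assumes "r mod 2 = s mod 2"
  shows "8 dvd r\<^sup>2 + 14 * r * s + s\<^sup>2 + 10 * r + 6 * s"
proof -
  from assms have "2 dvd r - s"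
    by (simp add: mod_eq_dvd_iff)
  then obtain k where "r - s = 2 * k" ..
  then have r: "r = s + 2 * k"
    by simp
  have "even (k * (k + 5))"
    by simp
  then obtain m where m: "k * (k + 5) = 2 * m" ..
  have "r\<^sup>2 + 14 * r * s + s\<^sup>2 + 10 * r + 6 * s
      = 16 * s\<^sup>2 + 32 * s * k + 16 * s + 4 * (k * (k + 5))"
    by (simp add: r power2_eq_square algebra_simps)
  also have "\<dots> = 8 * (2 * s\<^sup>2 + 4 * s * k + 2 * s + m)"
    by (simp add: m)
  finally show ?thesis
    by (rule dvdI)
qed

text \<open>The defining formula of $f_{2,1}$, meaningful for \<open>x \<noteq> 0\<close> not an integer power of \<open>q\<close>.\<close>

definition f21_formula :: "complex \<Rightarrow> complex \<Rightarrow> complex" where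
  "f21_formula x q =
     Theta x q / qpoch_inf q q ^ 3 *
     (\<Sum>\<^sub>\<infinity>(r, s) \<in> {(r, s). r mod 2 = s mod 2}.
        sg2 r s *
        ((- 1) powi ((r - s) div 2) *
         q powi ((r\<^sup>2 + 14 * r * s + s\<^sup>2 + 10 * r + 6 * s) div 8)) /
        (1 - x * q powi ((r + s) div 2)))"

text \<open>At an integer power of \<open>q\<close>, a removable singularity of the formula, the value is that of the
  holomorphic extension, i.e. the limit of the formula.\<close>

definition f21 :: "complex \<Rightarrow> complex \<Rightarrow> complex" where
  "f21 x q =
     (if \<exists>n::int. x = q powi n
      then Lim (at x) (\<lambda>z. f21_formula z q)
      else f21_formula x q)"

text \<open>To be used for positive \<open>a\<close>, \<open>b\<close>, \<open>c\<close> with \<open>b\<^sup>2 - a * c > 0\<close>. The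
  binomial coefficient ``\<open>r\<close> choose 2'' means $r(r-1)/2$, also for negative \<open>r\<close>.\<close>

definition fabc :: "int \<Rightarrow> int \<Rightarrow> int \<Rightarrow> complex \<Rightarrow> complex \<Rightarrow> complex \<Rightarrow> complex" where
  "fabc a b c x y q =
     (\<Sum>\<^sub>\<infinity>(r, s) \<in> (UNIV :: (int \<times> int) set).
        sg2 r s * (- 1) powi (r + s) * x powi r * y powi s *
        q powi (a * (r * (r - 1) div 2) + b * r * s + c * (s * (s - 1) div 2)))"

end

theory Submission
  imports Defs
begin

text \<open>
  Write \<open>(x)_n\<close> for \<open>qpoch x q n\<close>, so that \<open>U(-x) = \<Sum> q^n (x)_n (q/x)_n\<close>. Each of the two identities
  comes from expanding the summand in its own way and summing first over \<open>n\<close>.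

  The Hecke-type series. By the finite Jacobi triple product, \<open>(x)_n (q/x)_n\<close> is the Laurent polynomial
  \<open>\<Sum> (-x)^j q^(j(j-1)/2) [2n, n+j]\<close> over \<open>-n \<le> j \<le> n\<close>, with \<open>[n, s]\<close> the Gaussian binomial. Hence the
  coefficient of \<open>(-x)^j q^(j(j-1)/2)\<close> in \<open>U(-x)\<close> is
  \<open>\<Sum> q^n (q)_2n / ((q)_(n-k) (q)_(n+k))\<close> over \<open>n \<ge> k = \<bar>j\<bar>\<close>. Expanding \<open>(q)_2n / (q)_(n+k)\<close> by the
  q-binomial theorem and summing over \<open>n\<close> by an identity of Euler turns it into
  \<open>1/(q)_\<infinity>\<close> times a partial theta series (\<open>U_coefficient_has_sum\<close>). The terms with \<open>j \<le> 0\<close>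
  make up the cone \<open>r, s \<ge> 0\<close> of \<open>f_{1,2,3}\<close>, those with \<open>j > 0\<close> the cone \<open>r, s < 0\<close>.

  The Appell-type series. There are numbers \<open>\<alpha>_r\<close>, independent of \<open>x\<close>, with
  \<open>1 = \<Sum> \<alpha>_r / ((q)_(n-r) (q)_(n+r+1))\<close> over \<open>r \<le> n\<close> (\<open>bailey_pair_beta_one\<close>): a Bailey pair
  with \<open>\<beta>_n = 1\<close>. Insert this factor in the summand of \<open>U(-x)\<close>. The sum over \<open>n\<close> is then a case of
  the q-Gauss sum, in which even the partial sums are products, and equals
  \<open>\<Theta>(x)/(q)_\<infinity>^3 q^r / ((1 - x q^r)(1 - q^(r+1)/x))\<close> (\<open>bailey_gamma_sums\<close>). Partial fractions
  split this into a pole at \<open>q^(-r)\<close> and one at \<open>q^(r+1)\<close>, which are the two cones of \<open>f_{2,1}\<close>. Bailey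
  inversion shows that \<open>\<alpha>_r\<close> is, up to elementary factors, the terminating value \<open>U(-q^(-r))\<close>, and a
  first-order recurrence in \<open>r\<close> evaluates the latter as a sum over pentagonal numbers (\<open>alpha_sum_eq\<close>).

  At an integer power of \<open>q\<close> the value of \<open>f_{2,1}\<close> is a limit of values at nearby points that are not
  powers of \<open>q\<close>, so the continuity of \<open>U\<close> carries the identity over.
\<close>

section \<open>Finite and infinite q-shifted factorials\<close>

lemma qpoch_0 [simp]: "qpoch x q 0 = 1"
  by (simp add: qpoch_def)

lemma qpoch_zero [simp]: "qpoch 0 q n = 1"
  by (simp add: qpoch_def)

lemma qpoch_Suc: "qpoch x q (Suc n) = qpoch x q n * (1 - x * q ^ n)"
  by (simp add: qpoch_def)

lemma qpoch_Suc_shift: "qpoch x q (Suc n) = (1 - x) * qpoch (x * q) q n"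
  unfolding qpoch_def by (subst prod.lessThan_Suc_shift) (simp add: mult.assoc)

lemma qpoch_add: "qpoch x q (m + n) = qpoch x q m * qpoch (x * q ^ m) q n"
  by (induction n) (simp_all add: qpoch_Suc power_add mult.assoc)

lemma qpoch_tendsto:
  assumes "norm q < 1"
  shows "(\<lambda>n. qpoch x q n) \<longlonglongrightarrow> qpoch_inf x q"
    and "(\<And>n. x * q ^ n \<noteq> 1) \<Longrightarrow> qpoch_inf x q \<noteq> 0"
proof -
  have "summable (\<lambda>i. norm x * norm q ^ i)"
    using assms by (intro summable_mult summable_geometric) auto
  then have "summable (\<lambda>i. norm ((1 - x * q ^ i) - 1))"
    by (simp add: norm_mult norm_power)
  then have conv: "convergent_prod (\<lambda>i. 1 - x * q ^ i)"
    by (intro abs_convergent_prod_imp_convergent_prod summable_imp_abs_convergent_prod)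
  then have "(\<lambda>n. qpoch x q (Suc n)) \<longlonglongrightarrow> qpoch_inf x q"
    unfolding qpoch_def qpoch_inf_def lessThan_Suc_atMost by (rule convergent_prod_LIMSEQ)
  then show "(\<lambda>n. qpoch x q n) \<longlonglongrightarrow> qpoch_inf x q"
    by (rule LIMSEQ_imp_Suc)
  show "qpoch_inf x q \<noteq> 0" if "\<And>n. x * q ^ n \<noteq> 1"
    unfolding qpoch_inf_def using that by (intro prodinf_nonzero conv) (metis right_minus_eq)
qed

lemma qpoch_inf_split:
  assumes "norm q < 1"
  shows "qpoch_inf x q = qpoch x q m * qpoch_inf (x * q ^ m) q"
proof -
  have "(\<lambda>n. qpoch x q (n + m)) \<longlonglongrightarrow> qpoch_inf x q"
    using qpoch_tendsto(1)[OF assms] by (rule LIMSEQ_ignore_initial_segment)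
  moreover have "(\<lambda>n. qpoch x q (n + m)) \<longlonglongrightarrow> qpoch x q m * qpoch_inf (x * q ^ m) q"
    unfolding add.commute[of _ m] qpoch_add by (intro tendsto_intros qpoch_tendsto assms)
  ultimately show ?thesis
    by (rule LIMSEQ_unique)
qed

lemma one_minus_power_nz:
  fixes q :: complex
  assumes "norm q < 1"
  shows "1 - q ^ Suc n \<noteq> 0"
proof
  assume "1 - q ^ Suc n = 0"
  then have "norm q ^ Suc n = 1"
    by (metis eq_iff_diff_eq_0 norm_one norm_power)
  moreover have "norm q ^ Suc n < 1"
    using power_decreasing[of 1 "Suc n" "norm q"] assms by simp
  ultimately show False
    by simp
qed

lemma qpoch_self_Suc: "qpoch q q (Suc n) = qpoch q q n * (1 - q ^ Suc n)"
  by (simp add: qpoch_Suc)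

lemma qpoch_self_add: "qpoch q q (m + n) = qpoch q q m * qpoch (q ^ Suc m) q n"
  by (simp add: qpoch_add)

lemma qpoch_self_nz:
  assumes "norm q < 1"
  shows "qpoch q q n \<noteq> 0" "qpoch (q ^ Suc m) q n \<noteq> 0" "qpoch_inf q q \<noteq> 0"
    and "qpoch_inf (q ^ Suc m) q \<noteq> 0"
proof -
  show nz: "qpoch q q n \<noteq> 0" for n
    by (induction n) (use one_minus_power_nz[OF assms] in \<open>simp_all add: qpoch_self_Suc\<close>)
  show "qpoch (q ^ Suc m) q n \<noteq> 0"
    using nz[of "m + n"] by (simp add: qpoch_self_add)
  show nz': "qpoch_inf q q \<noteq> 0"
  proof (intro qpoch_tendsto(2) assms)
    show "q * q ^ n \<noteq> 1" for n
      using one_minus_power_nz[OF assms, of n] by auto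
  qed
  show "qpoch_inf (q ^ Suc m) q \<noteq> 0"
    using nz' qpoch_inf_split[OF assms, of q m] by auto
qed

lemma qpoch_bounded:
  assumes "norm q < 1"
  shows "\<exists>K>0. \<forall>n. norm (qpoch x q n) \<le> K"
proof -
  have "Bseq (\<lambda>n. qpoch x q n)"
    using qpoch_tendsto(1)[OF assms] convergentI convergent_imp_Bseq by blast
  then show ?thesis
    unfolding Bseq_def by blast
qed

lemma inverse_qpoch_bounded:
  assumes "norm q < 1"
  shows "\<exists>K>0. \<forall>n. norm (inverse (qpoch q q n)) \<le> K"
proof -
  have "(\<lambda>n. inverse (qpoch q q n)) \<longlonglongrightarrow> inverse (qpoch_inf q q)"
    using assms by (intro tendsto_inverse qpoch_tendsto qpoch_self_nz)
  then have "Bseq (\<lambda>n. inverse (qpoch q q n))"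
    using convergentI convergent_imp_Bseq by blast
  then show ?thesis
    unfolding Bseq_def by blast
qed

text \<open>
  The q-Gauss sum with last argument \<open>q\<close>. The difference of consecutive right-hand sides reduces to
  \<open>(1 - a z)(1 - b z) - (1 - z)(1 - a b z) = z (1 - a)(1 - b)\<close> with \<open>z = q^n\<close>, so the series
  telescopes.
\<close>

lemma q_gauss_partial_sum:
  assumes "\<And>n. qpoch q q n \<noteq> 0" "\<And>n. qpoch (a * b * q) q n \<noteq> 0"
  shows "(\<Sum>m\<le>n. qpoch a q m * qpoch b q m * q ^ m / (qpoch q q m * qpoch (a * b * q) q m)) =
    qpoch (a * q) q n * qpoch (b * q) q n / (qpoch q q n * qpoch (a * b * q) q n)"
proof (induction n)
  case (Suc n)
  define A B C D where "A = qpoch (a * q) q n" and "B = qpoch (b * q) q n"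
    and "C = qpoch q q n" and "D = qpoch (a * b * q) q n"
  define z where "z = q ^ Suc n"
  have CD: "C \<noteq> 0" "D \<noteq> 0" "1 - z \<noteq> 0" "1 - a * b * z \<noteq> 0"
    using assms(1)[of n] assms(2)[of n] assms(1)[of "Suc n"] assms(2)[of "Suc n"]
    by (auto simp: C_def D_def qpoch_Suc z_def mult_ac)
  have "(\<Sum>m\<le>Suc n. qpoch a q m * qpoch b q m * q ^ m / (qpoch q q m * qpoch (a * b * q) q m)) =
    A * B / (C * D) + ((1 - a) * A) * ((1 - b) * B) * z / ((C * (1 - z)) * (D * (1 - a * b * z)))"
    using Suc.IH by (simp only: sum.atMost_Suc qpoch_Suc_shift[of a] qpoch_Suc_shift[of b])
      (simp add: qpoch_Suc A_def B_def C_def D_def z_def mult_ac)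
  also have "\<dots> = (A * (1 - a * z)) * (B * (1 - b * z)) / ((C * (1 - z)) * (D * (1 - a * b * z)))"
    using CD by (simp add: divide_simps) (simp add: algebra_simps)
  also have "\<dots> = qpoch (a * q) q (Suc n) * qpoch (b * q) q (Suc n) /
      (qpoch q q (Suc n) * qpoch (a * b * q) q (Suc n))"
    by (simp add: qpoch_Suc A_def B_def C_def D_def z_def mult_ac)
  finally show ?case .
qed auto

section \<open>Rearranging double series\<close>

lemma summable_on_product_bound:
  fixes f :: "nat \<Rightarrow> nat \<Rightarrow> complex"
  assumes "\<And>m n. norm (f m n) \<le> a m * b n" "summable a" "summable b"
    and "\<And>m. a m \<ge> 0" "\<And>n. b n \<ge> 0"
  shows "(\<lambda>(m, n). f m n) summable_on UNIV"
proof -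
  have sa: "(a has_sum suminf a) UNIV" and sb: "(b has_sum suminf b) UNIV"
    using assms by (auto intro!: norm_summable_imp_has_sum summable_sums)
  have "(\<lambda>(m, n). a m * b n) summable_on Sigma UNIV (\<lambda>_. UNIV)"
    by (rule summable_on_SigmaI[where g = "\<lambda>m. a m * suminf b"])
      (use assms has_sum_imp_summable[OF has_sum_cmult_left[OF sa]]
        in \<open>auto intro!: has_sum_cmult_right sb\<close>)
  then have "(\<lambda>p. norm (case p of (m, n) \<Rightarrow> f m n)) summable_on (UNIV \<times> UNIV)"
    by (rule Infinite_Sum.abs_summable_on_comparison_test') (use assms(1) in auto)
  then show ?thesis
    using abs_summable_summable by fastforce
qed

text \<open>
  Every interchange of summation below has this shape: a double series over a quadrant is summed along
  rows and along antidiagonals.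
\<close>

lemma double_series_exchange:
  fixes f :: "nat \<Rightarrow> nat \<Rightarrow> complex"
  assumes "(\<lambda>(m, n). f m n) summable_on UNIV"
    and "\<And>m. ((\<lambda>n. f m n) has_sum g m) UNIV"
    and "\<And>k. h k = (\<Sum>m\<le>k. f m (k - m))"
  shows "\<exists>S. ((\<lambda>(m, n). f m n) has_sum S) UNIV \<and> (g has_sum S) UNIV \<and> (h has_sum S) UNIV"
proof (intro exI conjI)
  define S where "S = (\<Sum>\<^sub>\<infinity>(m, n). f m n)"
  show hs: "((\<lambda>(m, n). f m n) has_sum S) UNIV"
    unfolding S_def using assms(1) by (rule has_sum_infsum)
  then have "((\<lambda>(m, n). f m n) has_sum S) (Sigma UNIV (\<lambda>_. UNIV))"
    by simp
  then show "(g has_sum S) UNIV"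
    by (rule has_sum_SigmaD) (simp add: assms)
  have "((\<lambda>(m, n). f m n) has_sum S) UNIV \<longleftrightarrow>
      ((\<lambda>(k, m). f m (k - m)) has_sum S) (Sigma UNIV (\<lambda>k. {..k}))"
    by (rule has_sum_reindex_bij_witness[where i = "\<lambda>(k, m). (m, k - m)" and j = "\<lambda>(m, n). (m + n, m)"])
      auto
  with hs have "((\<lambda>(k, m). f m (k - m)) has_sum S) (Sigma UNIV (\<lambda>k. {..k}))"
    by simp
  then show "(h has_sum S) UNIV"
    by (rule has_sum_SigmaD) (simp add: assms(3) has_sum_finite)
qed

section \<open>The q-binomial theorem and the finite Jacobi triple product\<close>

lemma choose2_0 [simp]: "0 choose 2 = 0"
  by (simp add: numeral_2_eq_2)

lemma choose2_Suc: "Suc n choose 2 = (n choose 2) + n"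
  by (simp add: numeral_2_eq_2)

lemma choose2_add: "(m + n) choose 2 = (m choose 2) + (n choose 2) + m * n"
  by (induction n) (simp_all add: choose2_Suc)

lemma square_eq_choose2: "n * n = 2 * (n choose 2) + n"
  by (induction n) (simp_all add: choose2_Suc)

definition qbin :: "complex \<Rightarrow> nat \<Rightarrow> nat \<Rightarrow> complex" where
  "qbin q n s = (if s \<le> n then qpoch q q n / (qpoch q q s * qpoch q q (n - s)) else 0)"

lemma qbin_Suc_Suc:
  assumes "norm q < 1" "s \<le> n"
  shows "qbin q (Suc n) (Suc s) = qbin q n (Suc s) + q ^ (n - s) * qbin q n s"
proof (cases "s = n")
  case True
  then show ?thesis
    using qpoch_self_nz[OF assms(1)] by (simp add: qbin_def)
next
  case False
  then obtain d where n: "n = Suc (s + d)"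
    using assms(2) less_imp_Suc_add by fastforce
  have nz: "qpoch q q i \<noteq> 0" "1 - q ^ Suc i \<noteq> 0" for i
    using qpoch_self_nz[OF assms(1)] one_minus_power_nz[OF assms(1)] by auto
  define N A D u v where "N = qpoch q q n" and "A = qpoch q q s" and "D = qpoch q q d"
    and "u = q ^ Suc s" and "v = q ^ Suc d"
  have "q ^ Suc n = u * v"
    by (simp add: n u_def v_def power_add)
  then have "qbin q (Suc n) (Suc s) = N * (1 - u * v) / ((A * (1 - u)) * (D * (1 - v)))"
    unfolding qbin_def n Suc_diff_Suc by (simp add: N_def A_def D_def u_def v_def qpoch_self_Suc n)
  also have "\<dots> = N / ((A * (1 - u)) * D) + v * (N / (A * (D * (1 - v))))"
    using nz unfolding N_def A_def D_def u_def v_def by (simp add: divide_simps) (simp add: algebra_simps)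
  also have "\<dots> = qbin q n (Suc s) + q ^ (n - s) * qbin q n s"
    unfolding qbin_def n Suc_diff_Suc by (simp add: N_def A_def D_def u_def v_def qpoch_self_Suc n)
  finally show ?thesis .
qed

lemma q_binomial_theorem:
  assumes "norm q < 1"
  shows "qpoch x q n = (\<Sum>s\<le>n. (- x) ^ s * q ^ (s choose 2) * qbin q n s)"
proof (induction n)
  case 0
  then show ?case
    by (simp add: qbin_def)
next
  case (Suc n)
  let ?t = "\<lambda>n s. (- x) ^ s * q ^ (s choose 2) * qbin q n s"
  have q0: "qbin q n 0 = 1" for n
    using qpoch_self_nz[OF assms] by (simp add: qbin_def)
  have step: "?t (Suc n) (Suc s) = ?t n (Suc s) - x * q ^ n * ?t n s" if "s \<le> n" for s
  proof -
    have "q ^ n = q ^ s * q ^ (n - s)"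
      using that by (simp flip: power_add)
    then show ?thesis
      by (simp add: qbin_Suc_Suc[OF assms that] choose2_Suc power_add algebra_simps)
  qed
  have "(\<Sum>s\<le>Suc n. ?t (Suc n) s) = ?t n 0 + (\<Sum>s\<le>n. ?t n (Suc s) - x * q ^ n * ?t n s)"
  proof -
    have "(\<Sum>s\<le>n. ?t (Suc n) (Suc s)) = (\<Sum>s\<le>n. ?t n (Suc s) - x * q ^ n * ?t n s)"
      by (intro sum.cong refl step) simp
    moreover have "?t (Suc n) 0 = ?t n 0"
      by (simp add: q0)
    ultimately show ?thesis
      by (simp only: sum.atMost_Suc_shift)
  qed
  also have "\<dots> = (\<Sum>s\<le>Suc n. ?t n s) - x * q ^ n * (\<Sum>s\<le>n. ?t n s)"
    by (simp only: sum.atMost_Suc_shift sum_subtractf sum_distrib_left add_diff_eq)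
  also have "(\<Sum>s\<le>Suc n. ?t n s) = (\<Sum>s\<le>n. ?t n s)"
    by (simp add: qbin_def)
  finally show ?case
    using Suc.IH by (simp add: qpoch_Suc algebra_simps)
qed

text \<open>
  Reversing the order of the factors and pulling \<open>-x/q^i\<close> out of each; this turns the factors with
  negative powers of \<open>q\<close> in \<open>(x/q^n)_2n\<close> into \<open>(q/x)_n\<close>.
\<close>

lemma qpoch_reflect:
  assumes "x \<noteq> 0" "q \<noteq> 0"
  shows "qpoch (x / q ^ n) q n * q ^ (Suc n choose 2) = (- x) ^ n * qpoch (q / x) q n"
proof (induction n)
  case (Suc n)
  have "qpoch (x / q ^ Suc n) q (Suc n) = (1 - x / q ^ Suc n) * qpoch (x / q ^ n) q n"
    using assms by (simp add: qpoch_Suc_shift)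
  then have "qpoch (x / q ^ Suc n) q (Suc n) * q ^ (Suc (Suc n) choose 2) =
      (1 - x / q ^ Suc n) * q ^ Suc n * (qpoch (x / q ^ n) q n * q ^ (Suc n choose 2))"
    by (simp add: choose2_Suc[of "Suc n"] power_add)
  also have "\<dots> = (q ^ Suc n - x) * ((- x) ^ n * qpoch (q / x) q n)"
    unfolding Suc.IH using assms by (simp add: field_simps)
  also have "\<dots> = (- x) ^ Suc n * qpoch (q / x) q (Suc n)"
    using assms by (simp add: qpoch_Suc field_simps)
  finally show ?case .
qed (simp add: choose2_Suc)

lemma sum_symmetric_split:
  fixes g :: "nat \<Rightarrow> complex"
  shows "(\<Sum>s\<le>n + n. g s) = (\<Sum>j\<le>n. g (n - j)) + (\<Sum>j\<le>n. g (n + j)) - g n"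
proof -
  have "(\<Sum>s\<le>n + m. g s) = (\<Sum>s\<le>n. g s) + (\<Sum>j\<le>m. g (n + j)) - g n" for m
    by (induction m) auto
  moreover have "(\<Sum>s\<le>n. g s) = (\<Sum>j\<le>n. g (n - j))"
    by (rule sum.reindex_bij_witness[where i = "\<lambda>j. n - j" and j = "\<lambda>j. n - j"]) auto
  ultimately show ?thesis
    by simp
qed

text \<open>
  The q-binomial theorem for \<open>(x/q^n)_2n\<close>, re-centred at the middle term. The terms with \<open>-j\<close>
  and with \<open>j\<close> are kept as two sums over \<open>j \<ge> 0\<close>, which are exchanged by \<open>x \<mapsto> q/x\<close>; the middle
  term occurs in both, whence the subtraction.
\<close>

lemma finite_jacobi_triple_product:
  assumes "norm q < 1" "q \<noteq> 0" "x \<noteq> 0"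
  shows "qpoch x q n * qpoch (q / x) q n =
    (\<Sum>j\<le>n. (- (q / x)) ^ j * q ^ (j choose 2) * qbin q (n + n) (n + j)) +
    (\<Sum>j\<le>n. (- x) ^ j * q ^ (j choose 2) * qbin q (n + n) (n + j)) - qbin q (n + n) n"
proof -
  define t where "t s = (- (x / q ^ n)) ^ s * q ^ (s choose 2) * qbin q (n + n) s" for s
  define c where "c = q ^ (Suc n choose 2) / (- x) ^ n"
  have sym: "qbin q (n + n) (n - j) = qbin q (n + n) (n + j)" if "j \<le> n" for j
    using that by (simp add: qbin_def mult.commute)
  have scale: "(- (x / q ^ n)) ^ i * (q ^ n) ^ i = (- x) ^ i" for i
    using assms(2) by (simp flip: power_mult_distrib)
  have up: "c * t (n + j) = (- x) ^ j * q ^ (j choose 2) * qbin q (n + n) (n + j)" for j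
  proof -
    have "(Suc n choose 2) + ((n + j) choose 2) = n * (n + j) + (j choose 2)"
      using square_eq_choose2[of n] by (simp add: choose2_add choose2_Suc algebra_simps)
    then have "q ^ (Suc n choose 2) * q ^ ((n + j) choose 2) = (q ^ n) ^ (n + j) * q ^ (j choose 2)"
      by (metis power_add power_mult)
    then have "q ^ (Suc n choose 2) * ((- (x / q ^ n)) ^ (n + j) * q ^ ((n + j) choose 2)) =
        (- x) ^ n * ((- x) ^ j * q ^ (j choose 2))"
      using assms(2) by (simp add: power_divide flip: divide_minus_left)
        (simp add: field_simps power_add)
    then show ?thesis
      using assms(3) unfolding c_def t_def by (simp add: divide_simps)
  qed
  have down: "c * t (n - j) = (- (q / x)) ^ j * q ^ (j choose 2) * qbin q (n + n) (n + j)"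
    if jn: "j \<le> n" for j
  proof -
    obtain k where "n = j + k"
      using le_Suc_ex[OF jn] by blast
    then have n: "n = k + j"
      by simp
    have "(Suc n choose 2) + (k choose 2) = n * k + j + (j choose 2)"
      using square_eq_choose2[of k] unfolding n choose2_Suc choose2_add by (simp add: algebra_simps)
    then have "q ^ ((Suc n choose 2) + (k choose 2)) = q ^ (n * k + j + (j choose 2))"
      by (simp only:)
    then have "q ^ (Suc n choose 2) * q ^ (k choose 2) = (q ^ n) ^ k * q ^ j * q ^ (j choose 2)"
      by (simp only: power_add power_mult)
    then have "(- (x / q ^ n)) ^ k * (q ^ (Suc n choose 2) * q ^ (k choose 2)) =
        (- (x / q ^ n)) ^ k * ((q ^ n) ^ k * q ^ j * q ^ (j choose 2))"
      by (simp only:)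
    then have "q ^ (Suc n choose 2) * ((- (x / q ^ n)) ^ k * q ^ (k choose 2)) =
        ((- (x / q ^ n)) ^ k * (q ^ n) ^ k) * q ^ j * q ^ (j choose 2)"
      by (simp only: mult_ac)
    also have "\<dots> = (- x) ^ k * q ^ j * q ^ (j choose 2)"
      unfolding scale ..
    also have "(- x) ^ k * q ^ j = (- x) ^ n * (- (q / x)) ^ j"
    proof -
      have "(- x) ^ n * (- (q / x)) ^ j = (- x) ^ k * ((- x) * (- (q / x))) ^ j"
        by (simp only: n power_add power_mult_distrib mult.assoc)
      also have "(- x) * (- (q / x)) = q"
        using assms(3) by simp
      finally show ?thesis ..
    qed
    finally have "q ^ (Suc n choose 2) * ((- (x / q ^ n)) ^ k * q ^ (k choose 2)) / (- x) ^ n =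
        (- (q / x)) ^ j * q ^ (j choose 2)"
      using assms(3) by simp
    moreover have "n - j = k"
      by (simp add: n)
    then have "c * t (n - j) = q ^ (Suc n choose 2) * ((- (x / q ^ n)) ^ k * q ^ (k choose 2)) /
        (- x) ^ n * qbin q (n + n) (n + j)"
      unfolding c_def t_def sym[OF jn] by simp
    ultimately show ?thesis
      by (simp only:)
  qed
  have "(- x) ^ n * (qpoch x q n * qpoch (q / x) q n) =
      q ^ (Suc n choose 2) * qpoch (x / q ^ n) q (n + n)"
    using qpoch_reflect[OF assms(3,2), of n] assms(2) by (simp add: qpoch_add mult_ac)
  then have "qpoch x q n * qpoch (q / x) q n = c * qpoch (x / q ^ n) q (n + n)"
    using assms(3) by (simp add: c_def field_simps)
  also have "\<dots> = (\<Sum>j\<le>n. c * t (n - j)) + (\<Sum>j\<le>n. c * t (n + j)) - c * t (n + 0)"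
    unfolding q_binomial_theorem[OF assms(1)] sum_symmetric_split
    by (simp add: t_def sum_distrib_left algebra_simps)
  also have "\<dots> = (\<Sum>j\<le>n. (- (q / x)) ^ j * q ^ (j choose 2) * qbin q (n + n) (n + j)) +
      (\<Sum>j\<le>n. (- x) ^ j * q ^ (j choose 2) * qbin q (n + n) (n + j)) - qbin q (n + n) n"
    unfolding up using sum.cong[OF refl down, of "{..n}" "\<lambda>j. j"] by simp
  finally show ?thesis .
qed

section \<open>The coefficients of U as partial theta functions\<close>

text \<open>
  Euler's \<open>\<Sum> z^m/(q)_m = 1/(z)_\<infinity>\<close> at \<open>z = q^(s+1)\<close>. For \<open>z = q\<close> the partial sums are
  \<open>1/(q)_n\<close>; the step from \<open>z\<close> to \<open>q z\<close> multiplies the sum by \<open>1 - z\<close>, because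
  \<open>z^m (1 - q^m)/(q)_m = z z^(m-1)/(q)_(m-1)\<close>.
\<close>

lemma euler_has_sum:
  assumes "norm q < 1"
  shows "((\<lambda>m. q ^ (Suc s * m) / qpoch q q m) has_sum (qpoch q q s / qpoch_inf q q)) UNIV"
proof -
  define F where "F s m = q ^ (Suc s * m) / qpoch q q m" for s m
  have nz: "qpoch q q n \<noteq> 0" for n
    using qpoch_self_nz[OF assms] by auto
  have summ: "summable (\<lambda>m. norm (F s m))" for s
  proof -
    obtain K where K: "K > 0" "\<And>n. norm (inverse (qpoch q q n)) \<le> K"
      using inverse_qpoch_bounded[OF assms] by blast
    have "norm (norm (F s m)) \<le> norm q ^ m * K" for m
    proof -
      have "norm q ^ (Suc s * m) \<le> norm q ^ m"
        using assms by (intro power_decreasing) auto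
      then have "norm q ^ (Suc s * m) * norm (inverse (qpoch q q m)) \<le> norm q ^ m * K"
        using K by (intro mult_mono) auto
      then show ?thesis
        by (simp add: F_def norm_divide norm_mult norm_power norm_inverse divide_inverse)
    qed
    then have "\<exists>N. \<forall>m\<ge>N. norm (norm (F s m)) \<le> norm q ^ m * K"
      by simp
    moreover have "summable (\<lambda>m. norm q ^ m * K)"
      using assms by (intro summable_mult2 summable_geometric) auto
    ultimately show ?thesis
      by (rule summable_comparison_test)
  qed
  have "F s sums (qpoch q q s / qpoch_inf q q)" for s
  proof (induction s)
    case 0
    have "(\<Sum>m\<le>n. F 0 m) = inverse (qpoch q q n)" for n
      using q_gauss_partial_sum[of q 0 0 n] nz by (simp add: F_def divide_inverse)
    moreover have "(\<lambda>n. inverse (qpoch q q n)) \<longlonglongrightarrow> inverse (qpoch_inf q q)"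
      using assms by (intro tendsto_inverse qpoch_tendsto qpoch_self_nz)
    ultimately show ?case
      by (simp add: sums_def_le divide_inverse)
  next
    case (Suc s)
    define G where "G m = F s m - F (Suc s) m" for m
    have "G (Suc m) = q ^ Suc s * F s m" for m
    proof -
      have "G (Suc m) = q ^ (Suc s * Suc m) * (1 - q ^ Suc m) / qpoch q q (Suc m)"
        by (simp add: G_def F_def diff_divide_distrib power_add algebra_simps)
      moreover have "q ^ (Suc s * Suc m) = q ^ Suc s * q ^ (Suc s * m)"
        by (simp add: power_add)
      ultimately show ?thesis
        unfolding qpoch_self_Suc F_def
        by (simp only: nonzero_mult_divide_mult_cancel_right[OF one_minus_power_nz[OF assms]]
            times_divide_eq_right)
    qed
    then have "(\<lambda>m. G (Suc m)) sums (q ^ Suc s * (qpoch q q s / qpoch_inf q q))"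
      using Suc.IH by (simp only: sums_mult)
    then have "G sums (q ^ Suc s * (qpoch q q s / qpoch_inf q q))"
      by (subst (asm) sums_Suc_iff) (simp add: G_def F_def)
    from sums_diff[OF Suc.IH this] show ?case
      by (simp add: G_def qpoch_self_Suc algebra_simps diff_divide_distrib)
  qed
  from norm_summable_imp_has_sum[OF summ this] show ?thesis
    unfolding F_def .
qed

text \<open>
  With \<open>a = q^(2j)\<close> the general term of the second series is \<open>q^k (a q^(k+1))_k / (q)_k\<close>. Its expansion
  in powers of \<open>a\<close> has inner sums that Euler's identity evaluates, and every one of them contributes
  the same factor \<open>1/(q)_\<infinity>\<close>.
\<close>

lemma U_coefficient_has_sum:
  assumes "norm q < 1"
  shows "\<exists>T. \<forall>j. ((\<lambda>s. (-1) ^ s * q ^ (2 * j * s + 3 * (Suc s choose 2))) has_sum T j) UNIV \<and>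
    ((\<lambda>k. q ^ k * qpoch q q (2 * j + 2 * k) / (qpoch q q k * qpoch q q (2 * j + k)))
       has_sum (T j / qpoch_inf q q)) UNIV"
proof -
  have nz: "qpoch q q n \<noteq> 0" "qpoch_inf q q \<noteq> 0" for n
    using qpoch_self_nz[OF assms] by auto
  obtain K where K: "K > 0" "\<And>n. norm (inverse (qpoch q q n)) \<le> K"
    using inverse_qpoch_bounded[OF assms] by blast
  have "\<exists>T. ((\<lambda>s. (-1) ^ s * q ^ (2 * j * s + 3 * (Suc s choose 2))) has_sum T) UNIV \<and>
    ((\<lambda>k. q ^ k * qpoch q q (2 * j + 2 * k) / (qpoch q q k * qpoch q q (2 * j + k)))
       has_sum (T / qpoch_inf q q)) UNIV" for j
  proof -
    \<comment> \<open>Kept in this form because the bound below needs the summand \<open>s\<close> to be visible.\<close>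
    define e where "e s = 2 * j * s + (s choose 2) + s + s * s + s" for s
    define f where "f s m = (-1) ^ s * q ^ (e s + Suc s * m) / (qpoch q q s * qpoch q q m)" for s m
    define h where
      "h k = q ^ k * qpoch q q (2 * j + 2 * k) / (qpoch q q k * qpoch q q (2 * j + k))" for k
    define g where "g s = (-1) ^ s * q ^ (2 * j * s + 3 * (Suc s choose 2)) / qpoch_inf q q" for s
    have summ: "(\<lambda>(s, m). f s m) summable_on UNIV"
    proof (rule summable_on_product_bound)
      fix s m
      have "norm (f s m) = norm q ^ (e s + Suc s * m) *
          (norm (inverse (qpoch q q s)) * norm (inverse (qpoch q q m)))"
        by (simp add: f_def norm_divide norm_mult norm_power norm_inverse divide_simps)
      also have "\<dots> \<le> norm q ^ (s + m) * (K * K)"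
        using K assms by (intro mult_mono power_decreasing) (auto simp: e_def)
      finally show "norm (f s m) \<le> (norm q ^ s * K) * (norm q ^ m * K)"
        by (simp add: power_add mult_ac)
    qed (use assms K in \<open>auto intro!: summable_mult2 summable_geometric\<close>)
    have rows: "((\<lambda>m. f s m) has_sum g s) UNIV" for s
    proof -
      have e: "e s = 2 * j * s + 3 * (Suc s choose 2)"
        unfolding e_def choose2_Suc using square_eq_choose2[of s] by simp
      have "((\<lambda>m. (-1) ^ s * q ^ e s / qpoch q q s * (q ^ (Suc s * m) / qpoch q q m)) has_sum
          ((-1) ^ s * q ^ e s / qpoch q q s * (qpoch q q s / qpoch_inf q q))) UNIV"
        by (intro has_sum_cmult_right euler_has_sum assms)
      moreover have "(-1) ^ s * q ^ e s / qpoch q q s * (qpoch q q s / qpoch_inf q q) = g s"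
        using nz by (simp add: g_def e)
      moreover have "(\<lambda>m. (-1) ^ s * q ^ e s / qpoch q q s * (q ^ (Suc s * m) / qpoch q q m)) = f s"
        by (simp add: f_def power_add fun_eq_iff mult_ac)
      ultimately show ?thesis
        by simp
    qed
    have diag: "h k = (\<Sum>s\<le>k. f s (k - s))" for k
    proof -
      have e': "2 * j + 2 * k = (2 * j + k) + k"
        by simp
      have "h k = q ^ k * qpoch (q ^ Suc (2 * j + k)) q k / qpoch q q k"
        using nz unfolding h_def e' qpoch_self_add[of q "2 * j + k" k] by simp
      also have "\<dots> = (\<Sum>s\<le>k. f s (k - s))"
        unfolding q_binomial_theorem[OF assms, of "q ^ Suc (2 * j + k)"] sum_distrib_left sum_divide_distrib
      proof (intro sum.cong refl)
        fix s assume "s \<in> {..k}"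
        then obtain m where k: "k = s + m"
          using le_Suc_ex by auto
        have "Suc (2 * j + k) * s + (s choose 2) + k = e s + Suc s * m"
          by (simp add: e_def k algebra_simps)
        then have "q ^ k * ((q ^ Suc (2 * j + k)) ^ s * q ^ (s choose 2)) = q ^ (e s + Suc s * m)"
          by (metis power_add power_mult mult.commute)
        then have "q ^ k * ((- (q ^ Suc (2 * j + k))) ^ s * q ^ (s choose 2)) =
            (-1) ^ s * q ^ (e s + Suc s * m)"
          by (subst power_minus) (simp add: mult_ac)
        then have "q ^ k * ((- (q ^ Suc (2 * j + k))) ^ s * q ^ (s choose 2)) * qbin q k s / qpoch q q k
            = (-1) ^ s * q ^ (e s + Suc s * m) * (qbin q k s / qpoch q q k)"
          by simp
        also have "qbin q k s / qpoch q q k = 1 / (qpoch q q s * qpoch q q m)"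
          using nz by (simp add: qbin_def k)
        finally show "q ^ k * ((- (q ^ Suc (2 * j + k))) ^ s * q ^ (s choose 2) * qbin q k s) /
            qpoch q q k = f s (k - s)"
          by (simp add: f_def k mult_ac)
      qed
      finally show ?thesis .
    qed
    have "\<exists>S. (g has_sum S) UNIV \<and> (h has_sum S) UNIV"
      using double_series_exchange[OF summ rows diag] by auto
    then obtain S where S: "(g has_sum S) UNIV" "(h has_sum S) UNIV"
      by auto
    have "((\<lambda>s. g s * qpoch_inf q q) has_sum (S * qpoch_inf q q)) UNIV"
      by (intro has_sum_cmult_left S)
    moreover have "(\<lambda>s. g s * qpoch_inf q q) =
        (\<lambda>s. (-1) ^ s * q ^ (2 * j * s + 3 * (Suc s choose 2)))"
      using nz by (simp add: g_def fun_eq_iff)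
    ultimately show ?thesis
      using nz by (intro exI[of _ "S * qpoch_inf q q"]) (use S(2) in \<open>simp add: h_def[abs_def]\<close>)
  qed
  then show ?thesis
    by (intro choice allI)
qed

section \<open>U as a double series\<close>

text \<open>
  The term \<open>(r, s) = (j, s)\<close> of \<open>f_{1,2,3}(q y, q^3; q)\<close>.
\<close>

definition hecke_term :: "complex \<Rightarrow> complex \<Rightarrow> nat \<Rightarrow> nat \<Rightarrow> complex" where
  "hecke_term q y j s = (- y) ^ j * q ^ ((j choose 2) + j) *
     ((-1) ^ s * q ^ (2 * j * s + 3 * (Suc s choose 2)))"

text \<open>
  The half \<open>j \<ge> 0\<close> of the Laurent expansion of \<open>q^n (y)_n (q/y)_n\<close>; being a polynomial in \<open>y\<close>, it
  makes sense at \<open>y = 0\<close>, where it gives the middle term.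
\<close>

definition U_part :: "complex \<Rightarrow> complex \<Rightarrow> nat \<Rightarrow> complex" where
  "U_part q y n = q ^ n * (\<Sum>j\<le>n. (- y) ^ j * q ^ (j choose 2) * qbin q (n + n) (n + j))"

lemma summable_theta:
  fixes Y t :: real
  assumes "0 \<le> Y" "0 \<le> t" "t < 1"
  shows "summable (\<lambda>j. Y ^ j * t ^ (j choose 2))"
proof -
  have "(\<lambda>j. Y * t ^ j) \<longlonglongrightarrow> Y * 0"
    using assms by (intro tendsto_intros LIMSEQ_realpow_zero)
  then have "eventually (\<lambda>j. Y * t ^ j < 1 / 2) sequentially"
    by (rule order_tendstoD) simp
  then obtain N where N: "\<And>j. j \<ge> N \<Longrightarrow> Y * t ^ j < 1 / 2"
    unfolding eventually_sequentially by blast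
  show ?thesis
  proof (rule summable_ratio_test)
    fix j assume "j \<ge> N"
    have "Y ^ Suc j * t ^ (Suc j choose 2) = (Y * t ^ j) * (Y ^ j * t ^ (j choose 2))"
      by (simp add: choose2_Suc power_add mult_ac)
    also have "\<dots> \<le> 1 / 2 * (Y ^ j * t ^ (j choose 2))"
      using N[OF \<open>j \<ge> N\<close>] assms by (intro mult_right_mono) auto
    finally show "norm (Y ^ Suc j * t ^ (Suc j choose 2)) \<le> 1 / 2 * norm (Y ^ j * t ^ (j choose 2))"
      using assms by simp
  qed simp
qed

text \<open>
  Summing \<open>U_part\<close> over \<open>n\<close> and the double series over \<open>s\<close> leads to the same single series over \<open>j\<close>,
  up to the factor \<open>(q)_\<infinity>\<close>.
\<close>

lemma hecke_exchange:
  assumes "norm q < 1"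
  shows "\<exists>S. (U_part q y has_sum S) UNIV \<and>
    ((\<lambda>(j, s). hecke_term q y j s) has_sum (qpoch_inf q q * S)) UNIV"
proof -
  have nz: "qpoch q q n \<noteq> 0" "qpoch_inf q q \<noteq> 0" for n
    using qpoch_self_nz[OF assms] by auto
  obtain T where T:
    "\<And>j. ((\<lambda>s. (-1) ^ s * q ^ (2 * j * s + 3 * (Suc s choose 2))) has_sum T j) UNIV"
    "\<And>j. ((\<lambda>k. q ^ k * qpoch q q (2 * j + 2 * k) / (qpoch q q k * qpoch q q (2 * j + k)))
       has_sum (T j / qpoch_inf q q)) UNIV"
    using U_coefficient_has_sum[OF assms] by auto
  define c where "c j = (- y) ^ j * q ^ ((j choose 2) + j)" for j
  have c: "summable (\<lambda>j. norm (c j))"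
  proof -
    have "(\<lambda>j. norm (c j)) = (\<lambda>j. (norm y * norm q) ^ j * norm q ^ (j choose 2))"
      by (simp add: c_def norm_mult norm_power power_add power_mult_distrib fun_eq_iff)
    then show ?thesis
      using assms by (simp add: summable_theta)
  qed
  define f where "f j k = c j *
    (q ^ k * qpoch q q (2 * j + 2 * k) / (qpoch q q k * qpoch q q (2 * j + k)))" for j k
  obtain K where K: "K > 0" "\<And>n. norm (inverse (qpoch q q n)) \<le> K"
    using inverse_qpoch_bounded[OF assms] by blast
  obtain L where L: "L > 0" "\<And>n. norm (qpoch q q n) \<le> L"
    using qpoch_bounded[OF assms] by blast
  have "(\<lambda>(j, k). f j k) summable_on UNIV"
  proof (rule summable_on_product_bound)
    fix j k
    have "norm (f j k) = norm (c j) * (norm q ^ k * (norm (qpoch q q (2 * j + 2 * k)) *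
        (norm (inverse (qpoch q q k)) * norm (inverse (qpoch q q (2 * j + k))))))"
      by (simp add: f_def norm_divide norm_mult norm_power norm_inverse divide_simps)
    also have "\<dots> \<le> norm (c j) * (norm q ^ k * (L * (K * K)))"
      using K L by (intro mult_mono mult_left_mono) auto
    finally show "norm (f j k) \<le> norm (c j) * (norm q ^ k * (L * (K * K)))" .
  qed (use assms K L c in \<open>auto intro!: summable_mult2 summable_geometric\<close>)
  moreover have "((\<lambda>k. f j k) has_sum (c j * (T j / qpoch_inf q q))) UNIV" for j
    unfolding f_def by (intro has_sum_cmult_right T)
  moreover have "U_part q y n = (\<Sum>j\<le>n. f j (n - j))" for n
    unfolding U_part_def sum_distrib_left
  proof (intro sum.cong refl)
    fix j assume "j \<in> {..n}"
    then obtain k where n: "n = j + k"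
      using le_Suc_ex by auto
    have "n + n - (n + j) = k" "n + n = 2 * j + 2 * k" "n + j = 2 * j + k" "n + j \<le> n + n"
      by (simp_all add: n)
    then have "qbin q (n + n) (n + j) =
        qpoch q q (2 * j + 2 * k) / (qpoch q q k * qpoch q q (2 * j + k))"
      unfolding qbin_def by (simp only: if_True mult.commute)
    then show "q ^ n * ((- y) ^ j * q ^ (j choose 2) * qbin q (n + n) (n + j)) = f j (n - j)"
      by (simp add: f_def c_def n power_add)
  qed
  ultimately have "\<exists>S. ((\<lambda>(j, k). f j k) has_sum S) UNIV \<and>
      ((\<lambda>j. c j * (T j / qpoch_inf q q)) has_sum S) UNIV \<and> (U_part q y has_sum S) UNIV"
    by (rule double_series_exchange)
  then obtain S where S: "((\<lambda>j. c j * (T j / qpoch_inf q q)) has_sum S) UNIV"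
    "(U_part q y has_sum S) UNIV"
    by auto
  have "(\<lambda>(j, s). hecke_term q y j s) summable_on UNIV"
  proof (rule summable_on_product_bound)
    fix j s
    have "norm q ^ (2 * j * s + 3 * (Suc s choose 2)) \<le> norm q ^ s"
      using assms by (intro power_decreasing) (auto simp: choose2_Suc)
    then show "norm (hecke_term q y j s) \<le> norm (c j) * norm q ^ s"
      by (simp add: hecke_term_def c_def norm_mult norm_power mult_left_mono)
  qed (use assms c in \<open>auto intro!: summable_geometric\<close>)
  then have hs: "((\<lambda>(j, s). hecke_term q y j s) has_sum (\<Sum>\<^sub>\<infinity>(j, s). hecke_term q y j s)) (Sigma UNIV (\<lambda>_. UNIV))"
    by simp
  have "((\<lambda>j. c j * T j) has_sum (\<Sum>\<^sub>\<infinity>(j, s). hecke_term q y j s)) UNIV"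
    by (rule has_sum_SigmaD[OF hs]) (auto simp: hecke_term_def c_def intro!: has_sum_cmult_right T)
  moreover have "((\<lambda>j. qpoch_inf q q * (c j * (T j / qpoch_inf q q))) has_sum (qpoch_inf q q * S)) UNIV"
    by (intro has_sum_cmult_right S)
  then have "((\<lambda>j. c j * T j) has_sum (qpoch_inf q q * S)) UNIV"
    using nz by simp
  ultimately have "(\<Sum>\<^sub>\<infinity>(j, s). hecke_term q y j s) = qpoch_inf q q * S"
    by (rule has_sum_unique)
  with hs S(2) show ?thesis
    by auto
qed

lemma U_summand:
  assumes "norm q < 1" "q \<noteq> 0" "x \<noteq> 0"
  shows "q ^ n * qpoch x q n * qpoch (q / x) q n = U_part q (q / x) n + U_part q x n - U_part q 0 n"
proof -
  \<comment> \<open>At \<open>y = 0\<close> only \<open>j = 0\<close> survives, by the convention \<open>0^0 = 1\<close>.\<close>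
  have "(\<Sum>j\<le>n. (- 0) ^ j * q ^ (j choose 2) * qbin q (n + n) (n + j)) =
      (\<Sum>j\<le>n. if j = 0 then qbin q (n + n) n else 0)"
    by (intro sum.cong) auto
  then have "U_part q 0 n = q ^ n * qbin q (n + n) n"
    by (simp add: U_part_def)
  then show ?thesis
    unfolding mult.assoc finite_jacobi_triple_product[OF assms]
    by (simp add: U_part_def algebra_simps)
qed

lemma int_choose2: "int n * (int n - 1) div 2 = int (n choose 2)"
proof -
  have "int n * int n = 2 * int (n choose 2) + int n"
    using square_eq_choose2[of n] by (metis of_nat_add of_nat_mult of_nat_numeral)
  then have "int n * (int n - 1) = 2 * int (n choose 2)"
    by (simp add: algebra_simps)
  then show ?thesis
    by simp
qed

lemma fabc_term_nonneg:
  assumes "q \<noteq> 0"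
  shows "sg2 (int j) (int s) * (- 1) powi (int j + int s) * (inverse x * q\<^sup>2) powi int j *
      (q ^ 3) powi int s * q powi (1 * (int j * (int j - 1) div 2) + 2 * int j * int s +
        3 * (int s * (int s - 1) div 2)) = hecke_term q (q / x) j s"
proof -
  have "1 * (int j * (int j - 1) div 2) + 2 * int j * int s + 3 * (int s * (int s - 1) div 2) =
      int ((j choose 2) + 2 * j * s + 3 * (s choose 2))"
    by (simp only: int_choose2) simp
  moreover have "(- 1) powi (int j + int s) = (- 1 :: complex) ^ (j + s)"
    by (metis of_nat_add power_int_of_nat)
  moreover have "sg2 (int j) (int s) = 1"
    by (simp add: sg2_def sg_def)
  ultimately have "sg2 (int j) (int s) * (- 1) powi (int j + int s) * (inverse x * q\<^sup>2) powi int j *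
      (q ^ 3) powi int s * q powi (1 * (int j * (int j - 1) div 2) + 2 * int j * int s +
        3 * (int s * (int s - 1) div 2)) =
      (- 1) ^ (j + s) * (inverse x * q\<^sup>2) ^ j * (q ^ 3) ^ s * q ^ ((j choose 2) + 2 * j * s + 3 * (s choose 2))"
    by (simp only: power_int_of_nat mult_1)
  also have "\<dots> = (- 1) ^ (j + s) * inverse x ^ j *
      q ^ (2 * j + 3 * s + ((j choose 2) + 2 * j * s + 3 * (s choose 2)))"
    by (simp add: power_mult_distrib power_add power_mult)
  also have "2 * j + 3 * s + ((j choose 2) + 2 * j * s + 3 * (s choose 2)) =
      j + ((j choose 2) + j + (2 * j * s + 3 * (Suc s choose 2)))"
    by (simp add: choose2_Suc)
  also have "(- 1) ^ (j + s) * inverse x ^ j * q ^ (j + ((j choose 2) + j + (2 * j * s + 3 * (Suc s choose 2)))) =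
      ((- 1) * (q * inverse x)) ^ j * q ^ ((j choose 2) + j) *
        ((-1) ^ s * q ^ (2 * j * s + 3 * (Suc s choose 2)))"
    unfolding power_mult_distrib power_add[of q j] power_add[of q "(j choose 2) + j"]
      power_add[of "-1" j s] by (simp only: mult_ac)
  finally show ?thesis
    by (simp add: hecke_term_def divide_inverse)
qed

text \<open>
  The cone \<open>r, s < 0\<close>: the shift by 1 in \<open>j\<close> is why this cone yields the double series of
  \<open>hecke_term q x\<close> without its terms with \<open>j = 0\<close>, the latter being the series at 0.
\<close>

lemma fabc_term_neg:
  assumes "q \<noteq> 0" "x \<noteq> 0"
  shows "sg2 (- 1 - int j) (- 1 - int s) * (- 1) powi ((- 1 - int j) + (- 1 - int s)) *
      (inverse x * q\<^sup>2) powi (- 1 - int j) * (q ^ 3) powi (- 1 - int s) *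
      q powi (1 * ((- 1 - int j) * ((- 1 - int j) - 1) div 2) + 2 * (- 1 - int j) * (- 1 - int s) +
        3 * ((- 1 - int s) * ((- 1 - int s) - 1) div 2)) = hecke_term q x (Suc j) s"
proof -
  have ch: "(- 1 - int i) * ((- 1 - int i) - 1) div 2 = int (Suc (Suc i) choose 2)" for i
    using int_choose2[of "Suc (Suc i)"] by (simp add: algebra_simps)
  have "1 * ((- 1 - int j) * ((- 1 - int j) - 1) div 2) + 2 * (- 1 - int j) * (- 1 - int s) +
        3 * ((- 1 - int s) * ((- 1 - int s) - 1) div 2) =
      int ((Suc (Suc j) choose 2) + 2 * Suc j * Suc s + 3 * (Suc (Suc s) choose 2))"
    by (simp only: ch) (simp add: algebra_simps)
  moreover have "(- 1) powi ((- 1 - int j) + (- 1 - int s)) = (- 1 :: complex) ^ (j + s)"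
  proof -
    have "(- 1 - int j) + (- 1 - int s) = - int (Suc (Suc (j + s)))"
      by simp
    then show ?thesis
      by (simp only: power_int_minus power_int_of_nat) (simp flip: power_inverse)
  qed
  moreover have "sg2 (- 1 - int j) (- 1 - int s) = -1"
    by (simp add: sg2_def sg_def)
  moreover have "- 1 - int i = - int (Suc i)" for i
    by simp
  ultimately have "sg2 (- 1 - int j) (- 1 - int s) * (- 1) powi ((- 1 - int j) + (- 1 - int s)) *
      (inverse x * q\<^sup>2) powi (- 1 - int j) * (q ^ 3) powi (- 1 - int s) *
      q powi (1 * ((- 1 - int j) * ((- 1 - int j) - 1) div 2) + 2 * (- 1 - int j) * (- 1 - int s) +
        3 * ((- 1 - int s) * ((- 1 - int s) - 1) div 2)) =
      (- 1) * (- 1) ^ (j + s) * inverse ((inverse x * q\<^sup>2) ^ Suc j) * inverse ((q ^ 3) ^ Suc s) *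
       q ^ ((Suc (Suc j) choose 2) + 2 * Suc j * Suc s + 3 * (Suc (Suc s) choose 2))"
    by (simp only: power_int_of_nat power_int_minus)
  also have "(Suc (Suc j) choose 2) + 2 * Suc j * Suc s + 3 * (Suc (Suc s) choose 2) =
      2 * Suc j + (3 * Suc s + (((Suc j choose 2) + Suc j) + (2 * Suc j * s + 3 * (Suc s choose 2))))"
    unfolding choose2_Suc[of "Suc j"] choose2_Suc[of "Suc s"] by simp
  also have "(- 1) * (- 1) ^ (j + s) * inverse ((inverse x * q\<^sup>2) ^ Suc j) * inverse ((q ^ 3) ^ Suc s) *
      q ^ (2 * Suc j + (3 * Suc s + (((Suc j choose 2) + Suc j) + (2 * Suc j * s + 3 * (Suc s choose 2))))) =
      (- 1) * (- 1) ^ (j + s) * x ^ Suc j *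
        q ^ (((Suc j choose 2) + Suc j) + (2 * Suc j * s + 3 * (Suc s choose 2)))"
  proof -
    have "inverse ((inverse x * q\<^sup>2) ^ Suc j) * q ^ (2 * Suc j) = x ^ Suc j"
      using assms by (simp only: power_mult power_mult_distrib inverse_mult_distrib) (simp add: power_inverse field_simps)
    moreover have "inverse ((q ^ 3) ^ Suc s) * q ^ (3 * Suc s) = 1"
      using assms by (simp only: power_mult) (simp add: field_simps)
    moreover have "a * b * c * d * q ^ (2 * Suc j + (3 * Suc s + e)) =
        a * b * (c * q ^ (2 * Suc j)) * (d * q ^ (3 * Suc s)) * q ^ e" for a b c d e
      by (simp only: power_add mult_ac)
    ultimately show ?thesis
      by (simp only: mult_1_right)
  qed
  also have "(- 1) * (- 1) ^ (j + s) * x ^ Suc j = (- x) ^ Suc j * (-1) ^ s"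
    by (simp add: power_add power_minus[of x])
  finally show ?thesis
    by (simp add: hecke_term_def power_add mult_ac)
qed

lemma fabc_eq_hecke:
  assumes "q \<noteq> 0" "x \<noteq> 0"
    and "\<And>y. ((\<lambda>(j, s). hecke_term q y j s) has_sum H y) UNIV"
  shows "fabc 1 2 3 (inverse x * q\<^sup>2) (q ^ 3) q = H (q / x) + (H x - H 0)"
proof -
  define F where "F = (\<lambda>(r :: int, s :: int).
        sg2 r s * (- 1) powi (r + s) * (inverse x * q\<^sup>2) powi r * (q ^ 3) powi s *
        q powi (1 * (r * (r - 1) div 2) + 2 * r * s + 3 * (s * (s - 1) div 2)))"
  define A where "A = {(r :: int, s :: int). r \<ge> 0 \<and> s \<ge> 0}"
  define B where "B = {(r :: int, s :: int). r < 0 \<and> s < 0}"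
  have "((\<lambda>(j, s). hecke_term q (q / x) j s) has_sum H (q / x)) UNIV \<longleftrightarrow> (F has_sum H (q / x)) A"
  proof (rule has_sum_reindex_bij_witness[where i = "\<lambda>(r, s). (nat r, nat s)"
        and j = "\<lambda>(j, s). (int j, int s)"])
    show "F (case p of (j, s) \<Rightarrow> (int j, int s)) = (case p of (j, s) \<Rightarrow> hecke_term q (q / x) j s)"
      for p :: "nat \<times> nat"
      unfolding F_def by (cases p) (simp only: prod.case fabc_term_nonneg[OF assms(1)])
  qed (auto simp: A_def)
  then have hA: "(F has_sum H (q / x)) A"
    using assms(3) by simp
  have "((\<lambda>p. (case p of (j, s) \<Rightarrow> hecke_term q x j s) + (- 1) * (case p of (j, s) \<Rightarrow> hecke_term q 0 j s))
      has_sum (H x + (- 1) * H 0)) UNIV"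
    by (intro has_sum_add has_sum_cmult_right assms(3))
  also have "?this \<longleftrightarrow> ((\<lambda>(j, s). hecke_term q x j s) has_sum (H x + (- 1) * H 0)) {(j, s). j > 0}"
    by (rule has_sum_cong_neutral) (auto simp: hecke_term_def)
  also have "\<dots> \<longleftrightarrow> (F has_sum (H x + (- 1) * H 0)) B"
  proof (rule has_sum_reindex_bij_witness[where i = "\<lambda>(r, s). (nat (- r), nat (- s - 1))"
        and j = "\<lambda>(j, s). (- int j, - 1 - int s)"])
    fix p :: "nat \<times> nat" assume "p \<in> {(j, s). j > 0}"
    then obtain j s where p: "p = (Suc j, s)"
      by (cases p) (auto simp: gr0_conv_Suc)
    have "- int (Suc j) = - 1 - int j"
      by simp
    then show "F (case p of (j, s) \<Rightarrow> (- int j, - 1 - int s)) = (case p of (j, s) \<Rightarrow> hecke_term q x j s)"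
      unfolding p F_def prod.case by (simp only: fabc_term_neg[OF assms(1,2)])
  qed (auto simp: B_def)
  finally have hB: "(F has_sum (H x + (- 1) * H 0)) B" .
  have "(F has_sum (H (q / x) + (H x + (- 1) * H 0))) (A \<union> B)"
    using hA hB by (rule has_sum_Un_disjoint) (auto simp: A_def B_def)
  also have "?this \<longleftrightarrow> (F has_sum (H (q / x) + (H x + (- 1) * H 0))) UNIV"
    by (rule has_sum_cong_neutral) (auto simp: A_def B_def F_def sg2_def sg_def split: if_splits)
  finally have "infsum F UNIV = H (q / x) + (H x - H 0)"
    by (simp add: infsumI)
  then show ?thesis
    unfolding fabc_def F_def .
qed

lemma U_eq_fabc:
  assumes "0 < norm q" "norm q < 1" "x \<noteq> 0"
  shows "U (- x) q = 1 / qpoch_inf q q * fabc 1 2 3 (inverse x * q\<^sup>2) (q ^ 3) q"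
proof -
  have q: "q \<noteq> 0"
    using assms by auto
  obtain S where S: "\<And>y. (U_part q y has_sum S y) UNIV"
    "\<And>y. ((\<lambda>(j, s). hecke_term q y j s) has_sum (qpoch_inf q q * S y)) UNIV"
    using hecke_exchange[OF assms(2)] by metis
  have "((\<lambda>n. U_part q (q / x) n + (U_part q x n + (- 1) * U_part q 0 n)) has_sum
      (S (q / x) + (S x + (- 1) * S 0))) UNIV"
    by (intro has_sum_add has_sum_cmult_right S)
  then have "((\<lambda>n. q ^ n * qpoch x q n * qpoch (q / x) q n) has_sum
      (S (q / x) + (S x + (- 1) * S 0))) UNIV"
    by (simp only: U_summand[OF assms(2) q assms(3)] mult_minus1 add_uminus_conv_diff add_diff_eq)
  then have U: "U (- x) q = S (q / x) + (S x - S 0)"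
    unfolding U_def using has_sum_imp_sums sums_unique by fastforce
  have "fabc 1 2 3 (inverse x * q\<^sup>2) (q ^ 3) q = qpoch_inf q q * U (- x) q"
    unfolding fabc_eq_hecke[OF q assms(3) S(2)] U by (simp only: distrib_left right_diff_distrib)
  then show ?thesis
    using qpoch_self_nz(3)[OF assms(2)] by simp
qed

section \<open>The Bailey pair relative to q with constant beta\<close>

text \<open>
  The Bailey pair relative to \<open>q\<close> with \<open>\<beta>_n = 1\<close> has \<open>\<alpha>_r = (1 - q^(2r+1)) alpha_sum q r\<close> when
  \<open>(q^2)_(n+r)\<close> in its definition is replaced by \<open>(q)_(n+r+1)\<close>.
\<close>

definition alpha_sum :: "complex \<Rightarrow> nat \<Rightarrow> complex" where
  "alpha_sum q r = (\<Sum>v\<in>{- int r..int r}.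
     (- 1) powi v * q powi (2 * (int r)\<^sup>2 + int r - v * (3 * v - 1) div 2))"

text \<open>
  The value of \<open>U(-x)\<close> at \<open>x = q^(-r)\<close>, where the factor \<open>(x)_n\<close> vanishes for \<open>n > r\<close>.
\<close>

definition terminating_U :: "complex \<Rightarrow> nat \<Rightarrow> complex" where
  "terminating_U q r = (\<Sum>j\<le>r. q ^ j * qpoch (1 / q ^ r) q j * qpoch (q ^ Suc r) q j)"

text \<open>
  A telescoping relation between the partial sums of \<open>U(-1/z)\<close> and \<open>U(-q/z)\<close>. The certificate is
  \<open>(1 - z)(1 - z^2) (q/z)_n (q z)_n\<close>; its coefficient is forced by comparing powers of \<open>q^n\<close>.
\<close>

lemma contiguous_partial_sum:
  fixes z q :: complex
  assumes "z \<noteq> 0"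
  shows "(\<Sum>n\<le>N. q ^ n * (qpoch (1 / z) q n * qpoch (q * z) q n) +
      z ^ 3 * (q ^ n * (qpoch (q / z) q n * qpoch z q n))) =
    z + z\<^sup>2 + (1 - z) * (1 - z\<^sup>2) * (qpoch (q / z) q N * qpoch (q * z) q N)"
proof (induction N)
  case 0
  show ?case
    by (simp add: algebra_simps power2_eq_square power3_eq_cube)
next
  case (Suc N)
  define P R Q where "P = qpoch (q / z) q N" and "R = qpoch (q * z) q N" and "Q = q ^ Suc N"
  have expand: "qpoch (1 / z) q (Suc N) = (1 - 1 / z) * P" "qpoch z q (Suc N) = (1 - z) * R"
    "qpoch (q * z) q (Suc N) = R * (1 - z * Q)" "qpoch (q / z) q (Suc N) = P * (1 - Q / z)"
    by (simp_all add: P_def R_def Q_def qpoch_Suc_shift[of "1 / z"] qpoch_Suc_shift[of z]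
        qpoch_Suc[of "q * z"] qpoch_Suc[of "q / z"] mult_ac)
  have factor: "P * R * (c * (a * b - 1)) = c * (P * a * (R * b)) - c * (P * R)" for a b c
    by (simp add: algebra_simps)
  have "Q * ((1 - 1 / z) * P * (R * (1 - z * Q))) + z ^ 3 * (Q * (P * (1 - Q / z) * ((1 - z) * R))) =
      P * R * ((1 - z) * (Q * (z ^ 3 - 1 / z) + Q\<^sup>2 * (1 - z\<^sup>2)))"
    using assms by (simp add: field_simps power2_eq_square power3_eq_cube)
  also have "(1 - z) * (Q * (z ^ 3 - 1 / z) + Q\<^sup>2 * (1 - z\<^sup>2)) =
      (1 - z) * (1 - z\<^sup>2) * ((1 - Q / z) * (1 - z * Q) - 1)"
    using assms by (simp add: field_simps power2_eq_square power3_eq_cube)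
  finally have step: "Q * ((1 - 1 / z) * P * (R * (1 - z * Q))) +
        z ^ 3 * (Q * (P * (1 - Q / z) * ((1 - z) * R))) =
      (1 - z) * (1 - z\<^sup>2) * (P * (1 - Q / z) * (R * (1 - z * Q))) - (1 - z) * (1 - z\<^sup>2) * (P * R)"
    unfolding factor .
  show ?case
    unfolding sum.atMost_Suc Suc.IH expand P_def[symmetric] R_def[symmetric] Q_def[symmetric] step
    by simp
qed

text \<open>
  At \<open>z = q^(r+1)\<close> and \<open>N = r + 1\<close> the boundary term of the telescoping sum contains the factor
  \<open>1 - q^r/q^r\<close>.
\<close>

lemma terminating_U_rec:
  assumes "q \<noteq> 0"
  shows "terminating_U q (Suc r) + q ^ (3 * Suc r) * terminating_U q r = q ^ Suc r + q ^ (2 * Suc r)"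
proof -
  define z where "z = q ^ Suc r"
  have z: "z \<noteq> 0" "q / z = 1 / q ^ r"
    using assms by (simp_all add: z_def)
  have zero: "qpoch (1 / q ^ r) q (Suc r) = 0"
    using assms by (simp add: qpoch_Suc)
  have "(\<Sum>n\<le>Suc r. q ^ n * (qpoch (1 / z) q n * qpoch (q * z) q n)) = terminating_U q (Suc r)"
    by (simp only: terminating_U_def z_def mult.assoc flip: power_Suc)
  moreover have "(\<Sum>n\<le>Suc r. q ^ n * (qpoch (q / z) q n * qpoch z q n)) = terminating_U q r"
    unfolding z(2) sum.atMost_Suc zero by (simp add: terminating_U_def z_def mult.assoc)
  moreover have "(\<Sum>n\<le>Suc r. q ^ n * (qpoch (1 / z) q n * qpoch (q * z) q n)) +
      z ^ 3 * (\<Sum>n\<le>Suc r. q ^ n * (qpoch (q / z) q n * qpoch z q n)) = z + z\<^sup>2"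
    using contiguous_partial_sum[OF z(1), of q "Suc r"]
    unfolding sum.distrib sum_distrib_left[symmetric] z(2) zero by simp
  ultimately show ?thesis
    by (simp only: z_def mult.commute[of _ "Suc r"] power_mult)
qed

lemma two_choose2: "2 * int (n choose 2) = int n * int n - int n"
  using square_eq_choose2[of n] by (metis add_diff_cancel_right' of_nat_add of_nat_mult of_nat_numeral)

text \<open>
  Both sides satisfy the same recurrence: multiplication by \<open>q^(4r+3)\<close> shifts the exponents of
  \<open>alpha_sum\<close> from \<open>r\<close> to \<open>r + 1\<close>, and the inhomogeneous terms \<open>q^(r+1)\<close> and \<open>q^(2r+2)\<close> of the
  recurrence for \<open>terminating_U\<close> give the new summands \<open>v = -r-1\<close> and \<open>v = r+1\<close>.
\<close>

lemma alpha_sum_eq: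
  assumes "q \<noteq> 0"
  shows "(-1) ^ r * q ^ (r choose 2) * terminating_U q r = alpha_sum q r"
proof (induction r)
  case 0
  show ?case
    by (simp add: terminating_U_def alpha_sum_def)
next
  case (Suc r)
  define w where "w v = v * (3 * v - 1) div 2" for v :: int
  have w: "2 * w v = v * (3 * v - 1)" for v
    unfolding w_def by (rule dvd_mult_div_cancel) auto
  define R where "R = int (Suc r)"
  have R: "2 * int (Suc r choose 2) = R * R - R"
    unfolding R_def by (rule two_choose2)
  let ?t = "\<lambda>r v. (- 1) powi v * q powi (2 * (int r)\<^sup>2 + int r - w v)"
  have iv: "{- int (Suc r)..int (Suc r)} = insert (int (Suc r)) (insert (- int (Suc r)) {- int r..int r})"
    by auto
  have "alpha_sum q (Suc r) = ?t (Suc r) (int (Suc r)) + (?t (Suc r) (- int (Suc r)) +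
      (\<Sum>v\<in>{- int r..int r}. ?t (Suc r) v))"
    unfolding alpha_sum_def iv w_def[symmetric] by (subst sum.insert, simp, simp)+ simp
  also have "?t (Suc r) (int (Suc r)) = (-1) ^ Suc r * q ^ ((Suc r choose 2) + 2 * Suc r)"
  proof -
    have "2 * (2 * R\<^sup>2 + R - w (R)) = 2 * (int (Suc r choose 2) + 2 * R)"
      using w[of "R"] R by (simp add: algebra_simps power2_eq_square)
    then have "2 * (int (Suc r))\<^sup>2 + int (Suc r) - w (int (Suc r)) = int ((Suc r choose 2) + 2 * Suc r)"
      by (simp add: R_def)
    then show ?thesis
      by (simp only: power_int_of_nat)
  qed
  also have "?t (Suc r) (- int (Suc r)) = (-1) ^ Suc r * q ^ ((Suc r choose 2) + Suc r)"
  proof -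
    have "2 * (2 * R\<^sup>2 + R - w (- R)) = 2 * (int (Suc r choose 2) + R)"
      using w[of "- R"] R by (simp add: algebra_simps power2_eq_square)
    then have "2 * (int (Suc r))\<^sup>2 + int (Suc r) - w (- int (Suc r)) = int ((Suc r choose 2) + Suc r)"
      by (simp add: R_def)
    moreover have "(- 1) powi (- int (Suc r)) = (-1 :: complex) ^ Suc r"
      by (simp only: power_int_minus power_int_of_nat) (simp flip: power_inverse)
    ultimately show ?thesis
      by (simp only: power_int_of_nat)
  qed
  also have "(\<Sum>v\<in>{- int r..int r}. ?t (Suc r) v) = q ^ (4 * r + 3) * alpha_sum q r"
    unfolding alpha_sum_def w_def[symmetric] sum_distrib_left
  proof (intro sum.cong refl)
    fix v
    have "2 * (int (Suc r))\<^sup>2 + int (Suc r) - w v = int (4 * r + 3) + (2 * (int r)\<^sup>2 + int r - w v)"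
      by (simp add: algebra_simps power2_eq_square)
    then have "q powi (2 * (int (Suc r))\<^sup>2 + int (Suc r) - w v) =
        q ^ (4 * r + 3) * q powi (2 * (int r)\<^sup>2 + int r - w v)"
      by (simp only: power_int_add[OF disjI1[OF assms]] power_int_of_nat)
    then show "?t (Suc r) v = q ^ (4 * r + 3) * ?t r v"
      by (simp only: mult_ac)
  qed
  also have "alpha_sum q r = (-1) ^ r * q ^ (r choose 2) * terminating_U q r"
    by (rule Suc.IH[symmetric])
  also have "(-1) ^ Suc r * q ^ ((Suc r choose 2) + 2 * Suc r) + ((-1) ^ Suc r * q ^ ((Suc r choose 2) + Suc r) +
      q ^ (4 * r + 3) * ((-1) ^ r * q ^ (r choose 2) * terminating_U q r)) =
      (-1) ^ Suc r * q ^ (Suc r choose 2) * (q ^ Suc r + q ^ (2 * Suc r) - q ^ (3 * Suc r) * terminating_U q r)"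
  proof -
    have "q ^ (4 * r + 3) * q ^ (r choose 2) = q ^ (Suc r choose 2) * q ^ (3 * Suc r)"
      by (simp add: choose2_Suc add_ac flip: power_add)
    then have "q ^ (4 * r + 3) * ((-1) ^ r * q ^ (r choose 2) * terminating_U q r) =
        - ((-1) ^ Suc r * q ^ (Suc r choose 2) * (q ^ (3 * Suc r) * terminating_U q r))"
      by (simp add: mult_ac)
    then show ?thesis
      unfolding power_add by (simp only:) (simp only: distrib_left right_diff_distrib mult.assoc, simp)
  qed
  also have "q ^ Suc r + q ^ (2 * Suc r) - q ^ (3 * Suc r) * terminating_U q r = terminating_U q (Suc r)"
    using terminating_U_rec[OF assms, of r] by (simp only: diff_eq_eq)
  finally show ?case ..
qed

text \<open>
  A very-well-poised sum whose partial sums are products: with \<open>u = q^M\<close>, \<open>y = q^N\<close> and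
  \<open>c = q^(2j+1)\<close> the telescoping step is
  \<open>u (1 - c u)(1 - y/u) + (1 - u)(1 - c u y) = (1 - y)(1 - c u^2)\<close>. The factor \<open>1 - q^(N-M)\<close> makes the
  full sum vanish for \<open>N > 0\<close>.
\<close>

lemma orthogonality_partial_sum:
  assumes "norm q < 1" "M \<le> N"
  shows "(\<Sum>m\<le>M. (1 - q ^ (2 * j + 2 * m + 1)) * (-1) ^ m * q ^ (m choose 2) * qpoch q q (2 * j + m) /
      (qpoch q q m * qpoch q q (N - m) * qpoch q q (N + 2 * j + m + 1))) * (1 - q ^ N) =
    (-1) ^ M * q ^ (Suc M choose 2) * qpoch q q (2 * j + M + 1) * (1 - q ^ (N - M)) /
      (qpoch q q M * qpoch q q (N - M) * qpoch q q (N + 2 * j + M + 1))"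
  using assms(2)
proof (induction M)
  case 0
  then show ?case
    by (simp add: choose2_Suc qpoch_self_Suc mult_ac)
next
  case (Suc M)
  obtain d where N: "N = Suc M + d"
    using Suc.prems le_Suc_ex by blast
  define u w c A B D E T where "u = q ^ Suc M" and "w = q ^ d" and "c = q ^ (2 * j + 1)"
    and "A = qpoch q q (2 * j + M + 1)" and "B = qpoch q q M" and "D = qpoch q q d"
    and "E = qpoch q q (N + 2 * j + M + 1)" and "T = q ^ (Suc M choose 2)"
  have nz: "B \<noteq> 0" "D \<noteq> 0" "E \<noteq> 0" "1 - u \<noteq> 0" "1 - q * w \<noteq> 0" "1 - c * u\<^sup>2 * w \<noteq> 0"
  proof -
    have "q * w = q ^ Suc d" "c * u\<^sup>2 * w = q ^ Suc (N + 2 * j + M + 1)"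
      by (simp_all add: w_def c_def u_def N power_add power2_eq_square power_mult power_mult_distrib)
    then show "1 - u \<noteq> 0" "1 - q * w \<noteq> 0" "1 - c * u\<^sup>2 * w \<noteq> 0"
      using one_minus_power_nz[OF assms(1)] unfolding u_def by metis+
  qed (use qpoch_self_nz[OF assms(1)] in \<open>simp_all add: B_def D_def E_def\<close>)
  have e: "N - M = Suc d" "N - Suc M = d" "q ^ N = u * w"
    "2 * j + Suc M = Suc (2 * j + M)" "2 * j + M + 1 = Suc (2 * j + M)"
    by (simp_all add: N u_def w_def power_add)
  have q1: "qpoch q q (N - M) = D * (1 - q * w)" "q ^ (N - M) = q * w"
    "qpoch q q (Suc M) = B * (1 - u)" "qpoch q q (2 * j + Suc M) = A"
    "qpoch q q (N + 2 * j + Suc M + 1) = E * (1 - c * u\<^sup>2 * w)"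
    "qpoch q q (2 * j + Suc M + 1) = A * (1 - c * u)"
    "q ^ (2 * j + 2 * Suc M + 1) = c * u\<^sup>2" "q ^ (Suc (Suc M) choose 2) = T * u"
  proof -
    show "qpoch q q (N - M) = D * (1 - q * w)" "q ^ (N - M) = q * w"
      by (simp_all add: e qpoch_self_Suc D_def w_def)
    show "qpoch q q (Suc M) = B * (1 - u)" "qpoch q q (2 * j + Suc M) = A"
      by (simp_all add: qpoch_self_Suc B_def u_def A_def)
    have "q ^ Suc (N + 2 * j + M + 1) = c * u\<^sup>2 * w"
      by (simp add: w_def c_def u_def N power_add power2_eq_square power_mult power_mult_distrib)
    moreover have "N + 2 * j + Suc M + 1 = Suc (N + 2 * j + M + 1)"
      by simp
    ultimately show "qpoch q q (N + 2 * j + Suc M + 1) = E * (1 - c * u\<^sup>2 * w)"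
      by (simp only: qpoch_self_Suc E_def)
    have "q ^ Suc (2 * j + M + 1) = c * u"
      by (simp add: c_def u_def power_add)
    moreover have "2 * j + Suc M + 1 = Suc (2 * j + M + 1)"
      by simp
    ultimately show "qpoch q q (2 * j + Suc M + 1) = A * (1 - c * u)"
      by (simp only: qpoch_self_Suc A_def)
    have "2 * j + 2 * Suc M + 1 = (2 * j + 1) + (Suc M + Suc M)"
      by simp
    then show "q ^ (2 * j + 2 * Suc M + 1) = c * u\<^sup>2"
      by (simp only: c_def u_def power_add power2_eq_square)
    show "q ^ (Suc (Suc M) choose 2) = T * u"
      unfolding choose2_Suc[of "Suc M"] by (simp add: T_def u_def power_add)
  qed
  have "(\<Sum>m\<le>Suc M. (1 - q ^ (2 * j + 2 * m + 1)) * (-1) ^ m * q ^ (m choose 2) * qpoch q q (2 * j + m) /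
      (qpoch q q m * qpoch q q (N - m) * qpoch q q (N + 2 * j + m + 1))) * (1 - q ^ N) =
      (-1) ^ M * T * A * (1 - q * w) / (B * (D * (1 - q * w)) * E) +
      (1 - c * u\<^sup>2) * (-1) ^ Suc M * T * A / (B * (1 - u) * D * (E * (1 - c * u\<^sup>2 * w))) * (1 - u * w)"
    unfolding sum.atMost_Suc distrib_right Suc.IH[OF Suc_leD[OF Suc.prems]]
    unfolding q1 e(2,3) A_def[symmetric] B_def[symmetric] D_def[symmetric] E_def[symmetric] T_def[symmetric]
    by (rule refl)
  also have "\<dots> = (-1) ^ Suc M * (T * u) * (A * (1 - c * u)) * (1 - w) / (B * (1 - u) * D * (E * (1 - c * u\<^sup>2 * w)))"
    using nz by (simp add: divide_simps) (simp add: algebra_simps power2_eq_square)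
  finally show ?case
    unfolding q1 e(2) by (simp add: D_def w_def)
qed

lemma orthogonality_sum:
  assumes "norm q < 1"
  shows "(\<Sum>m\<le>N. (1 - q ^ (2 * j + 2 * m + 1)) * (-1) ^ m * q ^ (m choose 2) * qpoch q q (2 * j + m) /
      (qpoch q q m * qpoch q q (N - m) * qpoch q q (N + 2 * j + m + 1))) = (if N = 0 then 1 else 0)"
proof (cases N)
  case 0
  then show ?thesis
    using qpoch_self_nz(1)[OF assms] one_minus_power_nz[OF assms, of "2 * j"]
    by (simp add: qpoch_self_Suc)
next
  case (Suc n)
  have "(\<Sum>m\<le>N. (1 - q ^ (2 * j + 2 * m + 1)) * (-1) ^ m * q ^ (m choose 2) * qpoch q q (2 * j + m) /
      (qpoch q q m * qpoch q q (N - m) * qpoch q q (N + 2 * j + m + 1))) * (1 - q ^ N) = 0"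
    by (subst orthogonality_partial_sum[OF assms order_refl]) simp
  moreover have "1 - q ^ N \<noteq> 0"
    unfolding Suc by (rule one_minus_power_nz[OF assms])
  ultimately show ?thesis
    unfolding mult_eq_0_iff using Suc by simp
qed

lemma terminating_factor:
  assumes "norm q < 1" "q \<noteq> 0"
  shows "(-1) ^ (j + m) * q ^ ((j + m) choose 2) *
      (q ^ j * qpoch (1 / q ^ (j + m)) q j * qpoch (q ^ Suc (j + m)) q j) =
    (-1) ^ m * q ^ (m choose 2) * qpoch q q (2 * j + m) / qpoch q q m"
proof -
  have nz: "qpoch q q n \<noteq> 0" for n
    using qpoch_self_nz[OF assms(1)] by auto
  have "qpoch (1 / q ^ m / q ^ j) q j * q ^ (Suc j choose 2) =
      (- (1 / q ^ m)) ^ j * qpoch (q / (1 / q ^ m)) q j"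
    using assms(2) by (intro qpoch_reflect) auto
  moreover have "1 / q ^ m / q ^ j = 1 / q ^ (j + m)" "q / (1 / q ^ m) = q ^ Suc m"
    by (simp_all add: power_add mult.commute)
  ultimately have "qpoch (1 / q ^ (j + m)) q j * q ^ (Suc j choose 2) * q ^ (m * j) =
      (- (1 / q ^ m)) ^ j * (q ^ m) ^ j * qpoch (q ^ Suc m) q j"
    by (simp only: power_mult) (simp only: mult_ac)
  also have "(- (1 / q ^ m)) ^ j * (q ^ m) ^ j = (-1) ^ j"
    using assms(2) by (simp flip: power_mult_distrib)
  also have "qpoch (q ^ Suc m) q j = qpoch q q (j + m) / qpoch q q m"
    using nz[of m] qpoch_self_add[of q m j] by (simp add: field_simps)
  finally have refl: "qpoch (1 / q ^ (j + m)) q j * (q ^ (Suc j choose 2) * q ^ (m * j)) =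
      (-1) ^ j * (qpoch q q (j + m) / qpoch q q m)"
    by (simp only: mult.assoc)
  have up: "qpoch (q ^ Suc (j + m)) q j = qpoch q q (2 * j + m) / qpoch q q (j + m)"
  proof -
    have "2 * j + m = (j + m) + j"
      by simp
    then have "qpoch q q (2 * j + m) = qpoch q q (j + m) * qpoch (q ^ Suc (j + m)) q j"
      by (simp only: qpoch_self_add)
    then show ?thesis
      using nz by simp
  qed
  have e: "q ^ ((j + m) choose 2) * q ^ j = q ^ (m choose 2) * (q ^ (Suc j choose 2) * q ^ (m * j))"
    by (simp add: choose2_add choose2_Suc mult.commute add_ac flip: power_add)
  have "(-1) ^ (j + m) * q ^ ((j + m) choose 2) *
      (q ^ j * qpoch (1 / q ^ (j + m)) q j * qpoch (q ^ Suc (j + m)) q j) =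
      (-1) ^ (j + m) * (q ^ ((j + m) choose 2) * q ^ j) *
      qpoch (1 / q ^ (j + m)) q j * qpoch (q ^ Suc (j + m)) q j"
    by (simp only: mult_ac)
  also have "\<dots> = (-1) ^ (j + m) * q ^ (m choose 2) *
      (qpoch (1 / q ^ (j + m)) q j * (q ^ (Suc j choose 2) * q ^ (m * j))) * qpoch (q ^ Suc (j + m)) q j"
    unfolding e by (simp only: mult_ac)
  also have "\<dots> = (-1) ^ (j + m) * (-1) ^ j * q ^ (m choose 2) * (qpoch q q (2 * j + m) / qpoch q q m)"
    unfolding refl up using nz by simp
  also have "(-1) ^ (j + m) * (-1) ^ j = (-1 :: complex) ^ m"
    by (simp add: power_add flip: power_mult_distrib)
  finally show ?thesis
    by simp
qed

text \<open>
  Bailey inversion: after writing \<open>alpha_sum\<close> as a sum over \<open>j \<le> r\<close> and interchanging the two sums, the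
  inner sum is the orthogonality sum, and only \<open>j = n\<close> survives.
\<close>

lemma bailey_pair_beta_one:
  assumes "norm q < 1" "q \<noteq> 0"
  shows "(\<Sum>r\<le>n. (1 - q ^ (2 * r + 1)) * alpha_sum q r /
      (qpoch q q (n - r) * qpoch q q (n + r + 1))) = 1"
proof -
  define f where "f j m = (1 - q ^ (2 * j + 2 * m + 1)) * (-1) ^ m * q ^ (m choose 2) *
      qpoch q q (2 * j + m) /
      (qpoch q q m * qpoch q q (n - j - m) * qpoch q q (n - j + 2 * j + m + 1))" for j m
  have "(\<Sum>r\<le>n. (1 - q ^ (2 * r + 1)) * alpha_sum q r / (qpoch q q (n - r) * qpoch q q (n + r + 1))) =
      (\<Sum>r\<le>n. \<Sum>j\<le>r. f j (r - j))"
  proof (intro sum.cong refl)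
    fix r assume "r \<in> {..n}"
    have "(1 - q ^ (2 * r + 1)) * alpha_sum q r / (qpoch q q (n - r) * qpoch q q (n + r + 1)) =
        (\<Sum>j\<le>r. (1 - q ^ (2 * r + 1)) * ((-1) ^ r * q ^ (r choose 2) *
          (q ^ j * qpoch (1 / q ^ r) q j * qpoch (q ^ Suc r) q j)) /
          (qpoch q q (n - r) * qpoch q q (n + r + 1)))"
      unfolding alpha_sum_eq[OF assms(2), symmetric] terminating_U_def
      by (simp only: sum_distrib_left sum_divide_distrib)
    also have "\<dots> = (\<Sum>j\<le>r. f j (r - j))"
    proof (intro sum.cong refl)
      fix j assume "j \<in> {..r}"
      then obtain m where r: "r = j + m"
        using le_Suc_ex by auto
      have e: "2 * j + 2 * m + 1 = 2 * (j + m) + 1" "n - j - m = n - (j + m)"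
        "n - j + 2 * j + m + 1 = n + (j + m) + 1"
        using \<open>r \<in> {..n}\<close> by (auto simp: r)
      show "(1 - q ^ (2 * r + 1)) * ((-1) ^ r * q ^ (r choose 2) *
          (q ^ j * qpoch (1 / q ^ r) q j * qpoch (q ^ Suc r) q j)) /
          (qpoch q q (n - r) * qpoch q q (n + r + 1)) = f j (r - j)"
        unfolding r terminating_factor[OF assms] add_diff_cancel_left' f_def e
        by (simp add: mult_ac)
    qed
    finally show "(1 - q ^ (2 * r + 1)) * alpha_sum q r / (qpoch q q (n - r) * qpoch q q (n + r + 1)) =
        (\<Sum>j\<le>r. f j (r - j))" .
  qed
  also have "\<dots> = (\<Sum>(j, m)\<in>{(j, m). j + m \<le> n}. f j m)"
    by (rule sum.triangle_reindex_eq[symmetric])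
  also have "{(j, m). j + m \<le> n} = Sigma {..n} (\<lambda>j. {..n - j})"
    by auto
  also have "(\<Sum>(j, m)\<in>Sigma {..n} (\<lambda>j. {..n - j}). f j m) = (\<Sum>j\<le>n. \<Sum>m\<le>n - j. f j m)"
    by (subst sum.Sigma) auto
  also have "\<dots> = (\<Sum>j\<le>n. if j = n then 1 else 0)"
    unfolding f_def orthogonality_sum[OF assms(1)] by (intro sum.cong) auto
  finally show ?thesis
    by simp
qed

section \<open>The Bailey lemma applied to U\<close>

lemma pentagonal_exponent_bound:
  assumes "v \<in> {- int r..int r}"
  shows "v * (3 * v - 1) div 2 \<le> 2 * (int r)\<^sup>2 + int r"
proof -
  have "- v \<le> int r"
    using assms by simp
  have "\<bar>v\<bar> \<le> \<bar>int r\<bar>"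
    using assms by auto
  then have sq: "v\<^sup>2 \<le> (int r)\<^sup>2"
    by (simp only: abs_le_square_iff)
  have "3 * a - b \<le> 2 * (2 * c + d)" if "a \<le> c" "0 \<le> c" "- b \<le> d" "0 \<le> d" for a b c d :: int
    using that by presburger
  from this[OF sq _ \<open>- v \<le> int r\<close>] have "3 * v\<^sup>2 - v \<le> 2 * (2 * (int r)\<^sup>2 + int r)"
    by simp
  then have "v * (3 * v - 1) \<le> 2 * (2 * (int r)\<^sup>2 + int r)"
    by (simp add: algebra_simps power2_eq_square)
  then have "v * (3 * v - 1) div 2 \<le> 2 * (2 * (int r)\<^sup>2 + int r) div 2"
    by (rule zdiv_mono1) simp
  then show ?thesis
    by simp
qed

lemma norm_powi_le:
  fixes q :: complex
  assumes "norm q < 1" "int n \<le> k"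
  shows "norm (q powi k) \<le> norm q ^ n"
proof -
  obtain m where m: "k = int m"
    using assms(2) by (metis of_nat_0_le_iff order_trans zero_le_imp_eq_int)
  show ?thesis
    using assms unfolding m by (auto simp: norm_power intro!: power_decreasing)
qed

lemma norm_alpha_sum_le:
  assumes "norm q < 1"
  shows "norm (alpha_sum q r) \<le> 2 * real (Suc r)"
proof -
  have "norm (alpha_sum q r) \<le> (\<Sum>v\<in>{- int r..int r}. 1)"
    unfolding alpha_sum_def
  proof (rule sum_norm_le)
    fix v assume "v \<in> {- int r..int r}"
    then have "norm (q powi (2 * (int r)\<^sup>2 + int r - v * (3 * v - 1) div 2)) \<le> norm q ^ 0"
      using pentagonal_exponent_bound by (intro norm_powi_le assms) simp
    then show "norm ((- 1) powi v * q powi (2 * (int r)\<^sup>2 + int r - v * (3 * v - 1) div 2)) \<le> 1"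
      by (simp add: norm_mult norm_power_int)
  qed
  also have "\<dots> \<le> 2 * real (Suc r)"
    by simp
  finally show ?thesis .
qed

lemma summable_linear_geometric:
  fixes q :: complex
  assumes "norm q < 1"
  shows "summable (\<lambda>r. real (Suc r) * norm q ^ r)"
  using geometric_deriv_sums[of "norm q"] assms by (auto simp: sums_iff)

lemma non_power_factors:
  fixes q x :: complex
  assumes "q \<noteq> 0" "x \<noteq> 0" "\<And>n :: int. x \<noteq> q powi n"
  shows "1 - x * q ^ r \<noteq> 0" "1 - q ^ Suc r / x \<noteq> 0"
proof -
  have "x \<noteq> inverse (q ^ r)"
    using assms(3)[of "- int r"] by (simp add: power_int_minus)
  then show "1 - x * q ^ r \<noteq> 0"
    using assms(1) by (metis eq_iff_diff_eq_0 inverse_unique mult.commute)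
  show "1 - q ^ Suc r / x \<noteq> 0"
    using assms(2) assms(3)[of "int (Suc r)"] unfolding power_int_of_nat by simp
qed

text \<open>
  After the shift \<open>n = r + m\<close> this is the q-Gauss series with parameters \<open>x q^r\<close> and \<open>q^(r+1)/x\<close>. The
  infinite products of its limit combine with the finite ones in front into \<open>\<Theta>\<close>, except for one missing
  factor each of \<open>(x)_\<infinity>\<close> and \<open>(q/x)_\<infinity>\<close>.
\<close>

lemma bailey_gamma_sums:
  assumes "norm q < 1" "q \<noteq> 0" "x \<noteq> 0" "\<And>n :: int. x \<noteq> q powi n"
  shows "(\<lambda>m. q ^ (r + m) * qpoch x q (r + m) * qpoch (q / x) q (r + m) /
      (qpoch q q m * qpoch q q (2 * r + m + 1))) sums
    (Theta x q / qpoch_inf q q ^ 3 * (q ^ r / ((1 - x * q ^ r) * (1 - q ^ Suc r / x))))"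
proof -
  define a b where "a = x * q ^ r" and "b = q / x * q ^ r"
  have ab: "a * b * q = q ^ Suc (2 * r + 1)"
    using assms(3) by (simp add: a_def b_def power_add mult_2)
  have nz: "qpoch q q n \<noteq> 0" "qpoch (a * b * q) q n \<noteq> 0" "qpoch_inf q q \<noteq> 0"
    "qpoch_inf (a * b * q) q \<noteq> 0" for n
    unfolding ab by (rule qpoch_self_nz[OF assms(1)])+
  have nz': "1 - a \<noteq> 0" "1 - b \<noteq> 0"
    using non_power_factors[OF assms(2-4), of r] by (simp_all add: a_def b_def)
  define C where "C = q ^ r * qpoch x q r * qpoch (q / x) q r / qpoch q q (2 * r + 1)"
  have "q ^ (r + m) * qpoch x q (r + m) * qpoch (q / x) q (r + m) /
      (qpoch q q m * qpoch q q (2 * r + m + 1)) =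
      C * (qpoch a q m * qpoch b q m * q ^ m / (qpoch q q m * qpoch (a * b * q) q m))" for m
  proof -
    have "2 * r + m + 1 = (2 * r + 1) + m"
      by simp
    then have "qpoch q q (2 * r + m + 1) = qpoch q q (2 * r + 1) * qpoch (a * b * q) q m"
      by (simp only: ab qpoch_self_add)
    then show ?thesis
      by (simp add: C_def a_def b_def power_add qpoch_add mult_ac)
  qed
  moreover have "(\<lambda>m. qpoch a q m * qpoch b q m * q ^ m / (qpoch q q m * qpoch (a * b * q) q m)) sums
      (qpoch_inf (a * q) q * qpoch_inf (b * q) q / (qpoch_inf q q * qpoch_inf (a * b * q) q))"
    unfolding sums_def_le q_gauss_partial_sum[OF nz(1,2)]
    using nz by (intro tendsto_intros qpoch_tendsto assms) auto
  ultimately have "(\<lambda>m. q ^ (r + m) * qpoch x q (r + m) * qpoch (q / x) q (r + m) /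
      (qpoch q q m * qpoch q q (2 * r + m + 1))) sums
      (C * (qpoch_inf (a * q) q * qpoch_inf (b * q) q / (qpoch_inf q q * qpoch_inf (a * b * q) q)))"
    by (simp only: sums_mult)
  also have "C * (qpoch_inf (a * q) q * qpoch_inf (b * q) q / (qpoch_inf q q * qpoch_inf (a * b * q) q)) =
      Theta x q / qpoch_inf q q ^ 3 * (q ^ r / ((1 - a) * (1 - b)))"
  proof -
    have "qpoch_inf x q = qpoch x q r * (1 - a) * qpoch_inf (a * q) q"
      using qpoch_inf_split[OF assms(1), of x "Suc r"] by (simp add: a_def qpoch_Suc mult_ac)
    moreover have "qpoch_inf (q / x) q = qpoch (q / x) q r * (1 - b) * qpoch_inf (b * q) q"
      using qpoch_inf_split[OF assms(1), of "q / x" "Suc r"] by (simp add: b_def qpoch_Suc mult_ac)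
    moreover have Q: "qpoch_inf q q = qpoch q q (2 * r + 1) * qpoch_inf (a * b * q) q"
      using qpoch_inf_split[OF assms(1), of q "2 * r + 1"] by (simp add: ab)
    have "Theta x q / qpoch_inf q q ^ 3 = qpoch_inf x q * qpoch_inf (q / x) q /
        (qpoch_inf q q * (qpoch q q (2 * r + 1) * qpoch_inf (a * b * q) q))"
      unfolding Q[symmetric] Theta_def using nz(3) by (simp add: power3_eq_cube)
    ultimately show ?thesis
      using nz nz' by (simp add: C_def mult_ac)
  qed
  finally show ?thesis
    by (simp add: a_def b_def mult.commute)
qed

lemma U_eq_bailey_series:
  assumes "norm q < 1" "q \<noteq> 0" "x \<noteq> 0" "\<And>n :: int. x \<noteq> q powi n"
  shows "((\<lambda>r. (1 - q ^ (2 * r + 1)) * alpha_sum q r * (Theta x q / qpoch_inf q q ^ 3 *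
      (q ^ r / ((1 - x * q ^ r) * (1 - q ^ Suc r / x))))) has_sum U (- x) q) UNIV"
proof -
  define \<delta> where "\<delta> n = q ^ n * qpoch x q n * qpoch (q / x) q n" for n
  define f where "f r m = (1 - q ^ (2 * r + 1)) * alpha_sum q r *
    (\<delta> (r + m) / (qpoch q q m * qpoch q q (2 * r + m + 1)))" for r m
  obtain K where K: "K > 0" "\<And>n. norm (inverse (qpoch q q n)) \<le> K"
    using inverse_qpoch_bounded[OF assms(1)] by blast
  obtain L where L: "L > 0" "\<And>n. norm (qpoch x q n) \<le> L"
    using qpoch_bounded[OF assms(1)] by blast
  obtain L' where L': "L' > 0" "\<And>n. norm (qpoch (q / x) q n) \<le> L'"
    using qpoch_bounded[OF assms(1)] by blast
  have summ: "(\<lambda>(r, m). f r m) summable_on UNIV"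
  proof (rule summable_on_product_bound)
    fix r m
    have "norm (1 - q ^ (2 * r + 1)) \<le> norm (1 :: complex) + norm (q ^ (2 * r + 1))"
      by (rule norm_triangle_ineq4)
    also have "\<dots> \<le> 2"
      using assms(1) by (simp add: norm_mult norm_power mult_le_one power_le_one)
    finally have two: "norm (1 - q ^ (2 * r + 1)) \<le> 2" .
    have "norm (f r m) = norm (1 - q ^ (2 * r + 1)) * norm (alpha_sum q r) *
        (norm q ^ (r + m) * norm (qpoch x q (r + m)) * norm (qpoch (q / x) q (r + m)) *
        (norm (inverse (qpoch q q m)) * norm (inverse (qpoch q q (2 * r + m + 1)))))"
      by (simp add: f_def \<delta>_def norm_divide norm_mult norm_power norm_inverse divide_simps)
    also have "\<dots> \<le> 2 * (2 * real (Suc r)) * (norm q ^ (r + m) * L * L' * (K * K))"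
      using K L L' two norm_alpha_sum_le[OF assms(1)] by (intro mult_mono) auto
    also have "\<dots> = real (Suc r) * norm q ^ r * (norm q ^ m * (4 * (L * L' * (K * K))))"
      by (simp add: power_add)
    finally show "norm (f r m) \<le> real (Suc r) * norm q ^ r * (norm q ^ m * (4 * (L * L' * (K * K))))" .
  qed (use assms K L L' in \<open>auto intro!: summable_mult2 summable_geometric summable_linear_geometric
        simp del: of_nat_Suc\<close>)
  \<comment> \<open>A row inherits unconditional summability from the double series, so its ordinary sum is its value.\<close>
  have rows: "((\<lambda>m. f r m) has_sum ((1 - q ^ (2 * r + 1)) * alpha_sum q r *
      (Theta x q / qpoch_inf q q ^ 3 * (q ^ r / ((1 - x * q ^ r) * (1 - q ^ Suc r / x)))))) UNIV" for r
  proof -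
    have "f r sums ((1 - q ^ (2 * r + 1)) * alpha_sum q r *
      (Theta x q / qpoch_inf q q ^ 3 * (q ^ r / ((1 - x * q ^ r) * (1 - q ^ Suc r / x)))))"
      unfolding f_def \<delta>_def by (intro sums_mult bailey_gamma_sums assms)
    moreover have "f r summable_on UNIV"
      by (rule summable_on_SigmaD1[where A = UNIV]) (use summ in simp_all)
    then have "(f r has_sum infsum (f r) UNIV) UNIV"
      by (rule has_sum_infsum)
    ultimately show ?thesis
      using has_sum_imp_sums sums_unique2 by metis
  qed
  have diag: "\<delta> n = (\<Sum>r\<le>n. f r (n - r))" for n
  proof -
    have "\<delta> n = \<delta> n * (\<Sum>r\<le>n. (1 - q ^ (2 * r + 1)) * alpha_sum q r /
        (qpoch q q (n - r) * qpoch q q (n + r + 1)))"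
      unfolding bailey_pair_beta_one[OF assms(1,2)] by simp
    also have "\<dots> = (\<Sum>r\<le>n. f r (n - r))"
      unfolding sum_distrib_left
    proof (intro sum.cong refl)
      fix r assume "r \<in> {..n}"
      then have "r + (n - r) = n" "2 * r + (n - r) + 1 = n + r + 1"
        by auto
      then show "\<delta> n * ((1 - q ^ (2 * r + 1)) * alpha_sum q r /
          (qpoch q q (n - r) * qpoch q q (n + r + 1))) = f r (n - r)"
        unfolding f_def by (simp only: times_divide_eq_right mult_ac)
    qed
    finally show ?thesis .
  qed
  obtain S where S: "((\<lambda>r. (1 - q ^ (2 * r + 1)) * alpha_sum q r * (Theta x q / qpoch_inf q q ^ 3 *
      (q ^ r / ((1 - x * q ^ r) * (1 - q ^ Suc r / x))))) has_sum S) UNIV" "(\<delta> has_sum S) UNIV"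
    using double_series_exchange[OF summ rows diag] by auto
  have "U (- x) q = S"
    using sums_unique[OF has_sum_imp_sums[OF S(2)]] by (simp add: U_def \<delta>_def[abs_def])
  with S(1) show ?thesis
    by simp
qed

section \<open>The double sum in the definition of f21\<close>

text \<open>
  Each cone of \<open>f_{2,1}\<close> is a sum of this form, with \<open>d u\<close> the simple fraction belonging to the pole of
  the row \<open>u\<close>; away from the poles these fractions form a bounded sequence.
\<close>

lemma pentagonal_double_sum:
  fixes d :: "nat \<Rightarrow> complex"
  assumes "norm q < 1" "q \<noteq> 0" "Bseq d"
  shows "\<exists>S. ((\<lambda>(u, v). d u * ((- 1) powi v * q powi (2 * (int u)\<^sup>2 + 2 * int u - v * (3 * v - 1) div 2)))
      has_sum S) (Sigma UNIV (\<lambda>u. {- int u..int u})) \<and>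
    ((\<lambda>u. d u * (q ^ u * alpha_sum q u)) has_sum S) UNIV"
proof -
  obtain C where C: "C > 0" "\<And>u. norm (d u) \<le> C"
    using assms(3) unfolding Bseq_def by blast
  define f where "f = (\<lambda>(u, v). d u * ((- 1) powi v *
    q powi (2 * (int u)\<^sup>2 + 2 * int u - v * (3 * v - 1) div 2)))"
  have bound: "norm (f (u, v)) \<le> C * norm q ^ u" if "v \<in> {- int u..int u}" for u v
  proof -
    have "norm (q powi (2 * (int u)\<^sup>2 + 2 * int u - v * (3 * v - 1) div 2)) \<le> norm q ^ u"
      using pentagonal_exponent_bound[OF that] by (intro norm_powi_le assms) simp
    then show ?thesis
      using C(2)[of u] C(1) by (auto simp: f_def norm_mult norm_power_int intro!: mult_mono)
  qed
  have "(\<lambda>u. real (2 * u + 1) * (C * norm q ^ u)) summable_on UNIV"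
  proof (rule norm_summable_imp_summable_on, rule summable_comparison_test)
    show "summable (\<lambda>u. real (Suc u) * norm q ^ u * (2 * C))"
      by (intro summable_mult2 summable_linear_geometric assms)
    have "norm (norm (real (2 * u + 1) * (C * norm q ^ u))) \<le> real (Suc u) * norm q ^ u * (2 * C)" for u
    proof -
      have "norm (norm (real (2 * u + 1) * (C * norm q ^ u))) = real (2 * u + 1) * (C * norm q ^ u)"
        using C by (simp add: abs_mult)
      also have "\<dots> \<le> (2 * real (Suc u)) * (C * norm q ^ u)"
        using C by (intro mult_right_mono) auto
      also have "\<dots> = real (Suc u) * norm q ^ u * (2 * C)"
        by (simp only: mult_ac)
      finally show ?thesis .
    qed
    then show "\<exists>N. \<forall>u\<ge>N. norm (norm (real (2 * u + 1) * (C * norm q ^ u))) \<le>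
        real (Suc u) * norm q ^ u * (2 * C)"
      by blast
  qed
  then have "(\<lambda>(u, v :: int). C * norm q ^ u) summable_on Sigma UNIV (\<lambda>u. {- int u..int u})"
    by (rule summable_on_SigmaI[rotated]) (use C in \<open>auto intro!: has_sum_finiteI\<close>)
  then have "(\<lambda>p. norm (f p)) summable_on Sigma UNIV (\<lambda>u. {- int u..int u})"
    by (rule Infinite_Sum.abs_summable_on_comparison_test') (use bound in auto)
  then have "f summable_on Sigma UNIV (\<lambda>u. {- int u..int u})"
    by (rule abs_summable_summable)
  then have hs: "(f has_sum infsum f (Sigma UNIV (\<lambda>u. {- int u..int u}))) (Sigma UNIV (\<lambda>u. {- int u..int u}))"
    by (rule has_sum_infsum)
  moreover have "((\<lambda>u. d u * (q ^ u * alpha_sum q u)) has_sum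
      infsum f (Sigma UNIV (\<lambda>u. {- int u..int u}))) UNIV"
  proof (rule has_sum_SigmaD[OF hs])
    fix u :: nat
    have "(\<Sum>v\<in>{- int u..int u}. f (u, v)) = d u * (q ^ u * alpha_sum q u)"
      unfolding alpha_sum_def sum_distrib_left
    proof (intro sum.cong refl)
      fix v
      have "2 * (int u)\<^sup>2 + 2 * int u - v * (3 * v - 1) div 2 =
          int u + (2 * (int u)\<^sup>2 + int u - v * (3 * v - 1) div 2)"
        by simp
      then have "q powi (2 * (int u)\<^sup>2 + 2 * int u - v * (3 * v - 1) div 2) =
          q ^ u * q powi (2 * (int u)\<^sup>2 + int u - v * (3 * v - 1) div 2)"
        by (simp only: power_int_add[OF disjI1[OF assms(2)]] power_int_of_nat)
      then show "f (u, v) = d u * (q ^ u * ((- 1) powi v *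
          q powi (2 * (int u)\<^sup>2 + int u - v * (3 * v - 1) div 2)))"
        unfolding f_def prod.case by (simp only: mult_ac)
    qed
    then show "((\<lambda>v. f (u, v)) has_sum d u * (q ^ u * alpha_sum q u)) {- int u..int u}"
      by (intro has_sum_finiteI) auto
  qed
  ultimately show ?thesis
    unfolding f_def by blast
qed

text \<open>
  In the coordinates \<open>u = (r+s)/2\<close>, \<open>v = (r-s)/2\<close> the denominator involves only \<open>u\<close> and the quadratic
  form is diagonal.
\<close>

lemma f21_exponent_rotated:
  fixes u v :: int
  shows "((u + v)\<^sup>2 + 14 * (u + v) * (u - v) + (u - v)\<^sup>2 + 10 * (u + v) + 6 * (u - v)) div 8 =
    2 * u\<^sup>2 + 2 * u - v * (3 * v - 1) div 2"
proof -
  have "even (v * (3 * v - 1))"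
    by auto
  then obtain k where k: "v * (3 * v - 1) = 2 * k" ..
  have "(u + v)\<^sup>2 + 14 * (u + v) * (u - v) + (u - v)\<^sup>2 + 10 * (u + v) + 6 * (u - v) =
      16 * u\<^sup>2 + 16 * u - 4 * (v * (3 * v - 1))"
    by (simp add: algebra_simps power2_eq_square)
  also have "\<dots> = 8 * (2 * u\<^sup>2 + 2 * u - k)"
    unfolding k by simp
  finally show ?thesis
    using k by simp
qed

lemma same_parity_cases:
  fixes r s :: int
  assumes "r mod 2 = s mod 2"
  shows "\<exists>u v. r = u + v \<and> s = u - v"
proof -
  have "2 dvd r - s"
    using assms by (simp add: mod_eq_dvd_iff)
  then obtain v where "r - s = 2 * v" ..
  then have "r = (s + v) + v \<and> s = (s + v) - v"
    by simp
  then show ?thesis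
    by blast
qed

lemma same_parity_rotated:
  fixes u v :: int
  shows "(u + v) mod 2 = (u - v) mod 2"
  by presburger

text \<open>
  In the rotated coordinates the cone \<open>r, s \<ge> 0\<close> is \<open>\<bar>v\<bar> \<le> u\<close> and the cone \<open>r, s < 0\<close> is its image
  under \<open>u \<mapsto> -1 - u\<close>, which preserves the exponent. So the two cones share the same row sums over \<open>v\<close>,
  and their fractions add up to the product of the two poles in the Bailey series.
\<close>

lemma f21_formula_eq_U:
  assumes "norm q < 1" "q \<noteq> 0" "x \<noteq> 0" "\<And>n :: int. x \<noteq> q powi n"
  shows "f21_formula x q = U (- x) q"
proof -
  define F where "F = (\<lambda>(r, s). sg2 r s * ((- 1) powi ((r - s) div 2) *
         q powi ((r\<^sup>2 + 14 * r * s + s\<^sup>2 + 10 * r + 6 * s) div 8)) /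
        (1 - x * q powi ((r + s) div 2)))"
  define E where "E u v = (- 1) powi v * q powi (2 * (int u)\<^sup>2 + 2 * int u - v * (3 * v - 1) div 2)"
    for u :: nat and v
  define A where "A = {(r :: int, s :: int). r mod 2 = s mod 2 \<and> r \<ge> 0 \<and> s \<ge> 0}"
  define B where "B = {(r :: int, s :: int). r mod 2 = s mod 2 \<and> r < 0 \<and> s < 0}"
  define dA dB where "dA u = 1 / (1 - x * q ^ u)" and "dB u = (q ^ Suc u / x) / (1 - q ^ Suc u / x)" for u
  let ?I = "Sigma UNIV (\<lambda>u. {- int u..int u})"
  have F: "F (u + v, u - v) = sg2 (u + v) (u - v) * ((- 1) powi v *
      q powi (2 * u\<^sup>2 + 2 * u - v * (3 * v - 1) div 2)) / (1 - x * q powi u)" for u v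
  proof -
    have "(u + v - (u - v)) div 2 = v" "(u + v + (u - v)) div 2 = u"
      by simp_all
    then show ?thesis
      unfolding F_def prod.case f21_exponent_rotated by (simp only:)
  qed
  note factors = non_power_factors[OF assms(2-4)]
  have q0: "(\<lambda>u. q ^ u) \<longlonglongrightarrow> 0"
    using assms(1) by (rule LIMSEQ_power_zero)
  have "(\<lambda>u. 1 / (1 - x * q ^ u)) \<longlonglongrightarrow> 1 / (1 - x * 0)"
    by (intro tendsto_intros q0) simp
  then have BA: "Bseq dA"
    unfolding dA_def[abs_def] by (intro convergent_imp_Bseq convergentI)
  obtain SA where SA: "((\<lambda>(u, v). dA u * E u v) has_sum SA) ?I"
    "((\<lambda>u. dA u * (q ^ u * alpha_sum q u)) has_sum SA) UNIV"
    using pentagonal_double_sum[OF assms(1,2) BA] unfolding E_def[symmetric]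
    by (elim exE conjE) (rule that)
  have q1: "(\<lambda>u. q ^ Suc u) \<longlonglongrightarrow> 0"
    by (rule LIMSEQ_Suc[OF q0])
  have "(\<lambda>u. (q ^ Suc u / x) / (1 - q ^ Suc u / x)) \<longlonglongrightarrow> (0 / x) / (1 - 0 / x)"
    using assms(3) by (intro tendsto_divide tendsto_diff tendsto_const q1) simp_all
  then have BB: "Bseq dB"
    unfolding dB_def[abs_def] by (intro convergent_imp_Bseq convergentI)
  obtain SB where SB: "((\<lambda>(u, v). dB u * E u v) has_sum SB) ?I"
    "((\<lambda>u. dB u * (q ^ u * alpha_sum q u)) has_sum SB) UNIV"
    using pentagonal_double_sum[OF assms(1,2) BB] unfolding E_def[symmetric]
    by (elim exE conjE) (rule that)
  have "((\<lambda>(u, v). dA u * E u v) has_sum SA) ?I \<longleftrightarrow> (F has_sum SA) A"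
  proof (rule has_sum_reindex_bij_witness[where i = "\<lambda>(r, s). (nat ((r + s) div 2), (r - s) div 2)"
        and j = "\<lambda>(u, v). (int u + v, int u - v)"])
    fix p assume "p \<in> ?I"
    then obtain u v where p: "p = (u, v)" "v \<in> {- int u..int u}"
      by auto
    then have "sg2 (int u + v) (int u - v) = 1"
      by (simp add: sg2_def sg_def)
    then show "F (case p of (u, v) \<Rightarrow> (int u + v, int u - v)) = (case p of (u, v) \<Rightarrow> dA u * E u v)"
      by (simp add: p F E_def dA_def)
  next
    fix p assume "p \<in> A"
    then obtain r s where rs: "p = (r, s)" "r mod 2 = s mod 2" "r \<ge> 0" "s \<ge> 0"
      by (auto simp: A_def)
    obtain u v where uv: "r = u + v" "s = u - v"
      using same_parity_cases[OF rs(2)] by auto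
    have "0 \<le> u" "- u \<le> v" "v \<le> u"
      using rs(3,4) uv by auto
    then show "(case (case p of (r, s) \<Rightarrow> (nat ((r + s) div 2), (r - s) div 2)) of
        (u, v) \<Rightarrow> (int u + v, int u - v)) = p"
      and "(case p of (r, s) \<Rightarrow> (nat ((r + s) div 2), (r - s) div 2)) \<in> ?I"
      by (simp_all add: rs(1) uv)
  qed (auto simp: A_def same_parity_rotated)
  with SA(1) have hA: "(F has_sum SA) A"
    by simp
  have "((\<lambda>(u, v). dB u * E u v) has_sum SB) ?I \<longleftrightarrow> (F has_sum SB) B"
  proof (rule has_sum_reindex_bij_witness[where i = "\<lambda>(r, s). (nat (- 1 - (r + s) div 2), (r - s) div 2)"
        and j = "\<lambda>(u, v). ((- 1 - int u) + v, (- 1 - int u) - v)"])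
    fix p assume "p \<in> ?I"
    then obtain u v where p: "p = (u, v)" "v \<in> {- int u..int u}"
      by auto
    then have sg: "sg2 ((- 1 - int u) + v) ((- 1 - int u) - v) = - 1"
      by (simp add: sg2_def sg_def)
    have "- 1 - int u = - int (Suc u)"
      by simp
    then have "q powi (- 1 - int u) = inverse (q ^ Suc u)"
      by (simp only: power_int_minus power_int_of_nat)
    then have "1 - x * q powi (- 1 - int u) = - (x / q ^ Suc u) * (1 - q ^ Suc u / x)"
      using assms(2,3) by (simp add: inverse_eq_divide right_diff_distrib del: power_Suc)
    then have den: "- 1 / (1 - x * q powi (- 1 - int u)) = dB u"
      using assms(2,3) unfolding dB_def by simp
    have "2 * (- 1 - int u)\<^sup>2 + 2 * (- 1 - int u) = 2 * (int u)\<^sup>2 + 2 * int u"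
      by (simp add: algebra_simps power2_eq_square)
    then have "F ((- 1 - int u) + v, (- 1 - int u) - v) =
        - 1 / (1 - x * q powi (- 1 - int u)) * E u v"
      unfolding F sg E_def by (simp only: times_divide_eq_left)
    then show "F (case p of (u, v) \<Rightarrow> ((- 1 - int u) + v, (- 1 - int u) - v)) =
        (case p of (u, v) \<Rightarrow> dB u * E u v)"
      unfolding p prod.case den .
  next
    fix p assume "p \<in> B"
    then obtain r s where rs: "p = (r, s)" "r mod 2 = s mod 2" "r < 0" "s < 0"
      by (auto simp: B_def)
    obtain u v where uv: "r = u + v" "s = u - v"
      using same_parity_cases[OF rs(2)] by auto
    have "u \<le> - 1" "u + 1 \<le> v" "v \<le> - 1 - u"
      using rs(3,4) uv by auto
    then show "(case (case p of (r, s) \<Rightarrow> (nat (- 1 - (r + s) div 2), (r - s) div 2)) of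
        (u, v) \<Rightarrow> ((- 1 - int u) + v, (- 1 - int u) - v)) = p"
      and "(case p of (r, s) \<Rightarrow> (nat (- 1 - (r + s) div 2), (r - s) div 2)) \<in> ?I"
      by (simp_all add: rs(1) uv)
  qed (auto simp: B_def same_parity_rotated)
  with SB(1) have hB: "(F has_sum SB) B"
    by simp
  have "(F has_sum (SA + SB)) (A \<union> B)"
    using hA hB by (rule has_sum_Un_disjoint) (auto simp: A_def B_def)
  also have "?this \<longleftrightarrow> (F has_sum (SA + SB)) {(r, s). r mod 2 = s mod 2}"
    by (rule has_sum_cong_neutral) (auto simp: A_def B_def F_def sg2_def sg_def split: if_splits)
  finally have inf: "infsum F {(r, s). r mod 2 = s mod 2} = SA + SB"
    by (rule infsumI)
  have "((\<lambda>u. Theta x q / qpoch_inf q q ^ 3 *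
      (dA u * (q ^ u * alpha_sum q u) + dB u * (q ^ u * alpha_sum q u))) has_sum
      (Theta x q / qpoch_inf q q ^ 3 * (SA + SB))) UNIV"
    by (intro has_sum_cmult_right has_sum_add SA SB)
  moreover have "Theta x q / qpoch_inf q q ^ 3 *
      (dA u * (q ^ u * alpha_sum q u) + dB u * (q ^ u * alpha_sum q u)) =
      (1 - q ^ (2 * u + 1)) * alpha_sum q u * (Theta x q / qpoch_inf q q ^ 3 *
      (q ^ u / ((1 - x * q ^ u) * (1 - q ^ Suc u / x))))" for u
  proof -
    have "1 / (1 - a) + b / (1 - b) = (1 - a * b) / ((1 - a) * (1 - b))"
      if "1 - a \<noteq> 0" "1 - b \<noteq> 0" for a b :: complex
      using that by (simp add: divide_simps) (simp add: algebra_simps)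
    from this[OF factors] have "dA u + dB u =
        (1 - x * q ^ u * (q ^ Suc u / x)) / ((1 - x * q ^ u) * (1 - q ^ Suc u / x))"
      unfolding dA_def dB_def .
    also have "x * q ^ u * (q ^ Suc u / x) = q ^ (2 * u + 1)"
      using assms(3) by (simp add: power_add mult_2)
    finally have "dA u + dB u = (1 - q ^ (2 * u + 1)) / ((1 - x * q ^ u) * (1 - q ^ Suc u / x))" .
    then have "dA u * (q ^ u * alpha_sum q u) + dB u * (q ^ u * alpha_sum q u) =
        (1 - q ^ (2 * u + 1)) / ((1 - x * q ^ u) * (1 - q ^ Suc u / x)) * (q ^ u * alpha_sum q u)"
      by (simp only: distrib_right[symmetric])
    then show ?thesis
      by (simp only: times_divide_eq_left times_divide_eq_right mult_ac)
  qed
  ultimately have "Theta x q / qpoch_inf q q ^ 3 * (SA + SB) = U (- x) q"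
    using U_eq_bailey_series[OF assms] has_sum_unique by (simp only:)
  then show ?thesis
    unfolding f21_formula_def F_def[symmetric] inf .
qed

section \<open>Removable singularities\<close>

text \<open>
  The majorant is again a q-shifted factorial, so it is bounded in \<open>n\<close>, and it depends on \<open>z\<close>
  only through \<open>R\<close>.
\<close>

lemma norm_qpoch_le:
  assumes "norm z \<le> R"
  shows "norm (qpoch z q n) \<le> norm (qpoch (- of_real R) (of_real (norm q)) n)"
  unfolding qpoch_def prod_norm[symmetric]
proof (intro prod_mono conjI)
  fix i
  have R: "0 \<le> R"
    using assms norm_ge_zero order_trans by blast
  have "norm (1 - z * q ^ i) \<le> 1 + norm z * norm q ^ i"
    using norm_triangle_ineq4[of 1 "z * q ^ i"] by (simp add: norm_mult norm_power)
  also have "\<dots> \<le> 1 + R * norm q ^ i"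
    using assms by (simp add: mult_right_mono)
  also have "\<dots> = norm (of_real (1 + R * norm q ^ i) :: complex)"
    unfolding norm_of_real using R by simp
  also have "of_real (1 + R * norm q ^ i) = (1 - (- of_real R) * of_real (norm q) ^ i :: complex)"
    by simp
  finally show "norm (1 - z * q ^ i) \<le> norm (1 - (- of_real R) * of_real (norm q) ^ i :: complex)" .
qed simp

text \<open>
  On an annulus around \<open>\<bar>x\<bar>\<close> both \<open>z\<close> and \<open>q/z\<close> are bounded, so the series is dominated by a geometric
  one and the convergence is uniform.
\<close>

lemma U_tendsto:
  assumes "norm q < 1" "x \<noteq> 0"
  shows "((\<lambda>z. U (- z) q) \<longlongrightarrow> U (- x) q) (at x)"
proof -
  define A where "A = {z :: complex. norm x / 2 < norm z \<and> norm z < 2 * norm x}"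
  have "open A"
    unfolding A_def by (intro open_Collect_conj open_Collect_less continuous_intros)
  have "x \<in> A"
    using assms by (simp add: A_def)
  have nz: "z \<noteq> 0" if "z \<in> A" for z
    using that by (auto simp: A_def)
  have qn: "norm (of_real (norm q) :: complex) < 1"
    using assms by simp
  obtain K where K: "K > 0" "\<And>n. norm (qpoch (- of_real (2 * norm x)) (of_real (norm q)) n) \<le> K"
    using qpoch_bounded[OF qn] by blast
  obtain L where L: "L > 0" "\<And>n. norm (qpoch (- of_real (2 * norm q / norm x)) (of_real (norm q)) n) \<le> L"
    using qpoch_bounded[OF qn] by blast
  have "uniform_limit A (\<lambda>n z. \<Sum>i<n. q ^ i * qpoch z q i * qpoch (q / z) q i)
      (\<lambda>z. \<Sum>i. q ^ i * qpoch z q i * qpoch (q / z) q i) sequentially"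
  proof (rule Weierstrass_m_test)
    show "summable (\<lambda>n. norm q ^ n * K * L)"
      using assms by (intro summable_mult2 summable_geometric) auto
    fix n z assume "z \<in> A"
    then have z: "norm z \<le> 2 * norm x" "norm x / 2 < norm z"
      by (simp_all add: A_def)
    have "norm (qpoch z q n) \<le> K"
      using norm_qpoch_le[OF z(1)] K(2) by (rule order_trans)
    moreover have "0 < norm x / 2"
      using assms(2) by simp
    then have "norm (q / z) \<le> norm q / (norm x / 2)"
      unfolding norm_divide using less_imp_le[OF z(2)] by (intro frac_le) simp_all
    then have "norm (q / z) \<le> 2 * norm q / norm x"
      by (simp add: mult.commute)
    then have "norm (qpoch (q / z) q n) \<le> L"
      by (rule order_trans[OF norm_qpoch_le L(2)])
    ultimately show "norm (q ^ n * qpoch z q n * qpoch (q / z) q n) \<le> norm q ^ n * K * L"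
      unfolding norm_mult norm_power using K(1) L(1) by (intro mult_mono order_refl) auto
  qed
  moreover have "continuous_on A (\<lambda>z. \<Sum>i<n. q ^ i * qpoch z q i * qpoch (q / z) q i)" for n
    unfolding qpoch_def using nz by (intro continuous_intros) auto
  ultimately have "continuous_on A (\<lambda>z. \<Sum>i. q ^ i * qpoch z q i * qpoch (q / z) q i)"
    by (intro uniform_limit_theorem[where F = sequentially]) auto
  then have "continuous_on A (\<lambda>z. U (- z) q)"
    by (simp add: U_def)
  then show ?thesis
    using \<open>open A\<close> \<open>x \<in> A\<close> by (simp add: continuous_on_eq_continuous_at isCont_def)
qed

text \<open>
  The moduli of distinct integer powers of \<open>q\<close> differ at least by the factor \<open>\<bar>q\<bar>\<close>.
\<close>

lemma powers_isolated:
  fixes q x :: complex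
  assumes "0 < norm q" "norm q < 1" "x = q powi N"
  shows "eventually (\<lambda>z. z \<noteq> 0 \<and> (\<forall>n :: int. z \<noteq> q powi n)) (at x)"
proof -
  have x: "norm x > 0"
    using assms by simp
  have lim: "((\<lambda>z. norm z) \<longlongrightarrow> norm x) (at x)"
    by (intro tendsto_intros)
  have "eventually (\<lambda>z. norm x * norm q < norm z) (at x)"
    using assms x by (intro order_tendstoD(1)[OF lim]) simp
  moreover have "eventually (\<lambda>z. norm z < norm x / norm q) (at x)"
    using assms x by (intro order_tendstoD(2)[OF lim]) (simp add: field_simps)
  moreover have "eventually (\<lambda>z. z \<noteq> x) (at x)"
    by (simp add: eventually_at_filter)
  ultimately show ?thesis
  proof eventually_elim
    case (elim z)
    have "z \<noteq> q powi n" for n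
    proof
      assume z: "z = q powi n"
      have q: "q \<noteq> 0"
        using assms by auto
      have "n = N \<or> (\<exists>k. n = N + int (Suc k)) \<or> (\<exists>k. N = n + int (Suc k))"
        unfolding zless_iff_Suc_zadd[symmetric] by linarith
      then consider "n = N" | k where "n = N + int (Suc k)" | k where "N = n + int (Suc k)"
        by blast
      then show False
      proof cases
        case 1
        then show False
          using elim assms(3) z by simp
      next
        case 2
        then have "norm z = norm x * norm q ^ Suc k"
          unfolding z assms(3) by (simp only: power_int_add[OF disjI1[OF q]] power_int_of_nat norm_mult norm_power)
        also have "\<dots> \<le> norm x * norm q ^ 1"
          using assms by (intro mult_left_mono power_decreasing) auto
        finally show False
          using elim by simp
      next
        case 3
        then have "norm x = norm z * norm q ^ Suc k"
          unfolding z assms(3) by (simp only: power_int_add[OF disjI1[OF q]] power_int_of_nat norm_mult norm_power)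
        also have "\<dots> \<le> norm z * norm q ^ 1"
          using assms by (intro mult_left_mono power_decreasing) auto
        finally show False
          using elim assms(1) by (simp add: field_simps)
      qed
    qed
    moreover have "z \<noteq> 0"
      using elim(1) x assms(1) by (auto simp: mult_less_0_iff)
    ultimately show ?case
      by blast
  qed
qed

lemma f21_eq_U:
  assumes "0 < norm q" "norm q < 1" "x \<noteq> 0"
  shows "f21 x q = U (- x) q"
proof (cases "\<exists>n :: int. x = q powi n")
  case True
  then obtain N :: int where N: "x = q powi N"
    by auto
  have "eventually (\<lambda>z. U (- z) q = f21_formula z q) (at x)"
    using powers_isolated[OF assms(1,2) N] f21_formula_eq_U[OF assms(2)] assms(1)
    by (auto elim!: eventually_mono)
  then have "((\<lambda>z. f21_formula z q) \<longlongrightarrow> U (- x) q) (at x)"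
    using U_tendsto[OF assms(2,3)] by (rule Lim_transform_eventually[rotated])
  then have "Lim (at x) (\<lambda>z. f21_formula z q) = U (- x) q"
    by (intro tendsto_Lim) simp_all
  with True show ?thesis
    by (simp add: f21_def)
next
  case False
  then show ?thesis
    using assms f21_formula_eq_U[of q x] by (auto simp: f21_def)
qed

theorem mainTheorem4:
  fixes q x :: complex
  assumes "0 < norm q" and "norm q < 1"
    and "x \<noteq> 0"
  shows "U (- x) q = f21 x q \<and>
         f21 x q = 1 / qpoch_inf q q * fabc 1 2 3 (inverse x * q\<^sup>2) (q ^ 3) q"
  using f21_eq_U[OF assms] U_eq_fabc[OF assms] by simp

end
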